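(* Let $N=N(\iota)$ be an increasing sequence and, for each $\iota$, let $\bm A,\bm B\in\mathbb{C}^{N\times N}$ be random orthogonal projection matrices with $\frac1N\operatorname{Tr}(\bm A)\to\alpha\in(0,1)$ and $\frac1N\operatorname{Tr}(\bm B)\to\beta\in(0,1)$ in probability as $\iota\to\infty$. Suppose that $\alpha=\frac12$ or $\beta=\frac12$, that the empirical spectral distribution of $\bm A\bm B\bm A$ converges in probability to $\mathsf{MANOVA}(\alpha,\beta)$, and that there is a sequence of integers $k=k(\iota)$ with $\log N=o(k)$ such that $$\max_{1\le a\le k}\left|\mathbb{E}\operatorname{Tr}\left(\Big(\frac{\bm A-\alpha\bm I_N}{\sqrt{\alpha(1-\alpha)}}\cdot\frac{\bm B-\beta\bm I_N}{\sqrt{\beta(1-\beta)}}\Big)^a\right)\right|\le\exp(o(k)).$$ Then $\lambda_{\max}(\bm A\bm B\bm A)=\|\bm A\bm B\|^2$ converges in probability to $\mathsf{edge}(\alpha,\beta)$.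
   Context: For $\alpha,\beta\in(0,1)$, $\mathsf{MANOVA}(\alpha,\beta)$ is the probability measure on $\mathbb{R}$ $$d\mu(x)=\frac{\sqrt{(r_+-x)(x-r_-)}}{2\pi x(1-x)}\mathbf 1_{[r_-,r_+]}(x)\,dx+(1-\min\{\alpha,\beta\})\delta_0+\max\{\alpha+\beta-1,0\}\delta_1,$$ where $r_\pm=r_\pm(\alpha,\beta)=\big(\sqrt{\alpha(1-\beta)}\pm\sqrt{\beta(1-\alpha)}\big)^2$ and $\delta_c$ is the Dirac mass at $c$. $\mathsf{edge}(\alpha,\beta)=1$ if $\alpha+\beta>1$ and $\mathsf{edge}(\alpha,\beta)=r_+(\alpha,\beta)$ if $\alpha+\beta\le1$. The empirical spectral distribution of a Hermitian $N\times N$ matrix with eigenvalues $\lambda_i$ is $\frac1N\sum_i\delta_{\lambda_i}$; random measures $\mu_\iota$ converge in probability to $\mu$ if $\int f d\mu_\iota\to\int f d\mu$ in probability for every continuous compactly supported $f$. "$\le\exp(o(k))$" means bounded by $\exp(\varepsilon_\iota k(\iota))$ for some sequence $\varepsilon_\iota\to0$. $\lambda_{\max}$ is the largest eigenvalue and $\|\cdot\|$ the operator norm. *)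

theory Defs
  imports "Jordan_Normal_Form.Char_Poly" "HOL-Probability.Probability"
    "HOL-Library.Landau_Symbols"
begin

definition orth_proj :: "nat \<Rightarrow> complex mat \<Rightarrow> bool" where
  "orth_proj n A \<longleftrightarrow> A \<in> carrier_mat n n \<and> A * A = A \<and>
     (\<forall>i<n. \<forall>j<n. A $$ (j, i) = cnj (A $$ (i, j)))"

definition mat_trace :: "complex mat \<Rightarrow> complex" where
  "mat_trace M = (\<Sum>i<dim_row M. M $$ (i, i))"

definition eigs :: "complex mat \<Rightarrow> complex multiset" where
  "eigs M = proots (char_poly M)"

(* integral of f against the empirical spectral distribution of a Hermitian matrix *)
definition esd_integral :: "complex mat \<Rightarrow> (real \<Rightarrow> real) \<Rightarrow> real" where
  "esd_integral M f = (\<Sum>z\<in>#eigs M. f (Re z)) / real (dim_row M)"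

definition lambda_max :: "complex mat \<Rightarrow> real" where
  "lambda_max M = Max (Re ` set_mset (eigs M))"

definition vec_norm :: "complex Matrix.vec \<Rightarrow> real" where
  "vec_norm x = sqrt (\<Sum>i<dim_vec x. (cmod (x $ i))\<^sup>2)"

definition op_norm :: "complex mat \<Rightarrow> real" where
  "op_norm M = Sup {vec_norm (M *\<^sub>v x) | x. x \<in> carrier_vec (dim_col M) \<and> vec_norm x = 1}"

definition r_plus :: "real \<Rightarrow> real \<Rightarrow> real" where
  "r_plus a b = (sqrt (a * (1 - b)) + sqrt (b * (1 - a)))\<^sup>2"

definition r_minus :: "real \<Rightarrow> real \<Rightarrow> real" where
  "r_minus a b = (sqrt (a * (1 - b)) - sqrt (b * (1 - a)))\<^sup>2"

definition manova_density :: "real \<Rightarrow> real \<Rightarrow> real \<Rightarrow> real" where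
  "manova_density a b x = sqrt ((r_plus a b - x) * (x - r_minus a b)) / (2 * pi * x * (1 - x))"

definition manova_integral :: "real \<Rightarrow> real \<Rightarrow> (real \<Rightarrow> real) \<Rightarrow> real" where
  "manova_integral a b f =
     (LINT x:{r_minus a b..r_plus a b}|lborel. f x * manova_density a b x)
     + (1 - min a b) * f 0 + max (a + b - 1) 0 * f 1"

definition edge :: "real \<Rightarrow> real \<Rightarrow> real" where
  "edge a b = (if a + b > 1 then 1 else r_plus a b)"

definition conv_in_prob ::
  "(nat \<Rightarrow> 'w measure) \<Rightarrow> (nat \<Rightarrow> 'w \<Rightarrow> 'b::metric_space) \<Rightarrow> 'b \<Rightarrow> bool" where
  "conv_in_prob P X c \<longleftrightarrow> (\<forall>e>0.
     (\<lambda>i. measure (P i) {w \<in> space (P i). dist (X i w) c > e}) \<longlonglongrightarrow> 0)"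

definition compact_supp :: "(real \<Rightarrow> real) \<Rightarrow> bool" where
  "compact_supp f \<longleftrightarrow> (\<exists>R. \<forall>x. \<bar>x\<bar> > R \<longrightarrow> f x = 0)"

end

theory Submission
  imports Defs "Jordan_Normal_Form.Schur_Decomposition"
begin

text \<open>Let \<open>M = X Y\<close> be the product of the two centered and normalised projections. Both factors satisfy
  a quadratic equation with constant term \<open>-1\<close>, which makes \<open>M + M\<^sup>-\<^sup>1\<close> Hermitian; hence every
  eigenvalue of \<open>M\<close> is real or has modulus one. For an even exponent \<open>a\<close> the real part of
  \<open>Tr (M ^ a)\<close> is therefore at least \<open>x ^ a - N\<close> for each real eigenvalue \<open>x\<close> of \<open>M\<close>. If
  \<open>\<alpha> + \<beta> \<le> 1\<close>, an eigenvalue of \<open>A B A\<close> beyond \<open>r_plus \<alpha> \<beta> + e\<close> produces a real eigenvalue of \<open>M\<close> beyond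
  \<open>1 + e / (2 \<sigma>)\<close> with \<open>\<sigma>\<^sup>2 = \<alpha> (1 - \<alpha>) \<beta> (1 - \<beta>)\<close>, so Markov's inequality and the moment bound rule out
  such eigenvalues. If \<open>\<alpha> + \<beta> > 1\<close> the edge is \<open>1\<close> and there is nothing to prove from above. The bound from below
  follows by testing the empirical spectral distribution against a high power of \<open>x\<close>.\<close>

unbundle no vec_syntax and no inner_syntax

subsection \<open>Hermitian matrices and orthogonal projections\<close>

text \<open>An eigenvalue \<open>l\<close> of \<open>A B A\<close> and an eigenvalue
  \<open>z\<close> of \<open>M\<close> over it are tied by \<open>z + 1 / z = \<mu>\<close>, where
  \<open>\<mu>\<close> is affine in \<open>l\<close> with slope \<open>1 / \<sigma>\<close>. The
  point \<open>l = r_plus \<alpha> \<beta>\<close> is exactly where \<open>\<mu> = 2\<close> and the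
  pair of roots leaves the unit circle; beyond it the larger root is at least
  \<open>\<mu> / 2\<close>, hence the \<open>2 \<sigma>\<close> in the bound. The condition \<alpha>
  + \<beta> \<le> 1 matters when the ranges of \<open>A\<close> and \<open>B\<close> meet: on a
  common vector \<open>M\<close> acts as \<open>(1 - \<alpha>) (1 - \<beta>) / \<sigma>\<close>, so
  only one of the two roots for \<open>l = 1\<close> occurs, and the condition makes it the larger
  one. In general \<open>M\<close> is not normal, so its moments are read through its eigenvalues
  alone, and those of modulus one may cost up to N. As log N = o(k), this loss and exp(o(k)) are
  negligible against the k-th power of a number above 1. Measurability of \<open>lambda_max\<close>
  is avoided: deviation events are covered by events defined through traces.\<close>

definition hermitian_mat :: "nat \<Rightarrow> complex mat \<Rightarrow> bool" where
  "hermitian_mat n H \<longleftrightarrow> H \<in> carrier_mat n n \<and> (\<forall>i<n. \<forall>j<n. H $$ (j, i) = cnj (H $$ (i, j)))"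

lemma orth_proj_iff_hermitian: "orth_proj n A \<longleftrightarrow> hermitian_mat n A \<and> A * A = A"
  by (auto simp: orth_proj_def hermitian_mat_def)

lemma cscalar_prod_sum:
  fixes u v :: "complex Matrix.vec"
  assumes "v \<in> carrier_vec n"
  shows "u \<bullet>c v = (\<Sum>i<n. u $ i * cnj (v $ i))"
  using assms by (auto simp: scalar_prod_def lessThan_atLeast0 intro!: sum.cong)

lemma mult_mat_vec_index_sum:
  assumes "A \<in> carrier_mat m n" "v \<in> carrier_vec n" "i < m"
  shows "(A *\<^sub>v v) $ i = (\<Sum>j<n. A $$ (i, j) * v $ j)"
  using assms by (auto simp: scalar_prod_def lessThan_atLeast0 intro!: sum.cong)

lemma mult_mat_index_sum:
  assumes "A \<in> carrier_mat m n" "B \<in> carrier_mat n p" "i < m" "j < p"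
  shows "(A * B) $$ (i, j) = (\<Sum>l<n. A $$ (i, l) * B $$ (l, j))"
  using assms by (auto simp: scalar_prod_def lessThan_atLeast0 intro!: sum.cong)

lemma cscalar_prod_commute:
  fixes u v :: "complex Matrix.vec"
  assumes "u \<in> carrier_vec n" "v \<in> carrier_vec n"
  shows "u \<bullet>c v = cnj (v \<bullet>c u)"
  using assms by (simp add: cscalar_prod_sum mult.commute)

lemma cscalar_prod_self:
  assumes "v \<in> carrier_vec n"
  shows "v \<bullet>c v = complex_of_real ((vec_norm v)\<^sup>2)"
proof -
  have "(vec_norm v)\<^sup>2 = (\<Sum>i<n. (cmod (v $ i))\<^sup>2)"
    using assms by (simp add: vec_norm_def sum_nonneg)
  then show ?thesis
    using assms by (simp add: cscalar_prod_sum complex_norm_square del: of_real_power)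
qed

lemma vec_norm_nonneg [simp]: "0 \<le> vec_norm v"
  by (simp add: vec_norm_def sum_nonneg)

lemma vec_norm_pos:
  assumes "v \<in> carrier_vec n" "v \<noteq> 0\<^sub>v n"
  shows "0 < vec_norm v"
proof -
  obtain i where "i < n" "v $ i \<noteq> 0"
    using assms by (metis carrier_vecD eq_vecI index_zero_vec)
  then have "0 < (\<Sum>i<n. (cmod (v $ i))\<^sup>2)"
    by (intro sum_pos2[where i = i]) auto
  then show ?thesis
    using assms by (simp add: vec_norm_def)
qed

lemma vec_norm_smult: "vec_norm (c \<cdot>\<^sub>v v) = cmod c * vec_norm v"
proof -
  have "(\<Sum>i<dim_vec v. (cmod ((c \<cdot>\<^sub>v v) $ i))\<^sup>2) = (cmod c)\<^sup>2 * (\<Sum>i<dim_vec v. (cmod (v $ i))\<^sup>2)"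
    unfolding sum_distrib_left by (intro sum.cong) (auto simp: norm_mult power_mult_distrib)
  then show ?thesis
    by (simp add: vec_norm_def real_sqrt_mult)
qed

lemma cscalar_prod_Cauchy_Schwarz:
  assumes "u \<in> carrier_vec n" "v \<in> carrier_vec n"
  shows "cmod (u \<bullet>c v) \<le> vec_norm u * vec_norm v"
proof -
  have "cmod (u \<bullet>c v) \<le> (\<Sum>i<n. \<bar>cmod (u $ i)\<bar> * \<bar>cmod (v $ i)\<bar>)"
    unfolding cscalar_prod_sum[OF assms(2)]
    by (rule order_trans[OF norm_sum]) (simp add: norm_mult)
  also have "\<dots> \<le> L2_set (\<lambda>i. cmod (u $ i)) {..<n} * L2_set (\<lambda>i. cmod (v $ i)) {..<n}"
    by (rule L2_set_mult_ineq)
  also have "\<dots> = vec_norm u * vec_norm v"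
    using assms by (simp add: L2_set_def vec_norm_def)
  finally show ?thesis .
qed

lemma hermitian_mat_adjoint:
  assumes H: "hermitian_mat n H" and u: "u \<in> carrier_vec n" and v: "v \<in> carrier_vec n"
  shows "(H *\<^sub>v u) \<bullet>c v = u \<bullet>c (H *\<^sub>v v)"
proof -
  have Hc: "H \<in> carrier_mat n n" and sym: "\<And>i j. i < n \<Longrightarrow> j < n \<Longrightarrow> cnj (H $$ (i, j)) = H $$ (j, i)"
    using H unfolding hermitian_mat_def by metis+
  have "(H *\<^sub>v u) \<bullet>c v = (\<Sum>i<n. \<Sum>j<n. H $$ (i, j) * u $ j * cnj (v $ i))"
    using Hc u v by (simp add: cscalar_prod_sum mult_mat_vec_index_sum sum_distrib_right
        del: index_mult_mat_vec)
  also have "\<dots> = (\<Sum>j<n. \<Sum>i<n. H $$ (i, j) * u $ j * cnj (v $ i))"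
    by (rule sum.swap)
  also have "\<dots> = (\<Sum>j<n. u $ j * cnj (\<Sum>i<n. H $$ (j, i) * v $ i))"
    unfolding cnj_sum sum_distrib_left by (intro sum.cong) (auto simp: sym)
  also have "\<dots> = u \<bullet>c (H *\<^sub>v v)"
    using Hc u v by (simp add: cscalar_prod_sum[of "H *\<^sub>v v" n] mult_mat_vec_index_sum
        del: index_mult_mat_vec)
  finally show ?thesis .
qed

lemma orth_proj_idem_vec:
  assumes "orth_proj n A" "v \<in> carrier_vec n"
  shows "A *\<^sub>v (A *\<^sub>v v) = A *\<^sub>v v"
  using assms by (metis assoc_mult_mat_vec orth_proj_def)

lemma orth_proj_cscalar_prod_self:
  assumes "orth_proj n A" "v \<in> carrier_vec n"
  shows "(A *\<^sub>v v) \<bullet>c v = complex_of_real ((vec_norm (A *\<^sub>v v))\<^sup>2)"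
proof -
  have A: "A \<in> carrier_mat n n" "hermitian_mat n A"
    using assms orth_proj_iff_hermitian[of n A] unfolding orth_proj_def by blast+
  have "(A *\<^sub>v v) \<bullet>c v = (A *\<^sub>v (A *\<^sub>v v)) \<bullet>c v"
    using assms by (simp add: orth_proj_idem_vec)
  also have "\<dots> = (A *\<^sub>v v) \<bullet>c (A *\<^sub>v v)"
    using A assms by (intro hermitian_mat_adjoint) auto
  also have "\<dots> = complex_of_real ((vec_norm (A *\<^sub>v v))\<^sup>2)"
    using A assms by (intro cscalar_prod_self[where n = n]) auto
  finally show ?thesis .
qed

lemma orth_proj_vec_norm_le:
  assumes "orth_proj n A" "v \<in> carrier_vec n"
  shows "vec_norm (A *\<^sub>v v) \<le> vec_norm v"
proof -
  have "A *\<^sub>v v \<in> carrier_vec n"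
    using assms unfolding orth_proj_def by (metis mult_mat_vec_carrier)
  then have "(vec_norm (A *\<^sub>v v))\<^sup>2 \<le> vec_norm (A *\<^sub>v v) * vec_norm v"
    using cscalar_prod_Cauchy_Schwarz[of "A *\<^sub>v v" n v] orth_proj_cscalar_prod_self[OF assms] assms(2)
    by (simp add: norm_power)
  then show ?thesis
    by (cases "vec_norm (A *\<^sub>v v) = 0") (auto simp: power2_eq_square less_le)
qed

subsection \<open>Traces of powers\<close>

lemma mat_trace_mult_commute:
  assumes "A \<in> carrier_mat m n" "B \<in> carrier_mat n m"
  shows "mat_trace (A * B) = mat_trace (B * A)"
proof -
  have "mat_trace (A * B) = (\<Sum>i<m. \<Sum>l<n. A $$ (i, l) * B $$ (l, i))"
    using assms by (simp add: mat_trace_def mult_mat_index_sum del: index_mult_mat(1))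
  also have "\<dots> = (\<Sum>l<n. \<Sum>i<m. A $$ (i, l) * B $$ (l, i))"
    by (rule sum.swap)
  also have "\<dots> = mat_trace (B * A)"
    using assms by (simp add: mat_trace_def mult_mat_index_sum mult.commute del: index_mult_mat(1))
  finally show ?thesis .
qed

lemma upper_triangular_pow_mat:
  fixes T :: "'a :: comm_semiring_1 mat"
  assumes T: "T \<in> carrier_mat n n" and ut: "upper_triangular T"
  shows "upper_triangular (T ^\<^sub>m a) \<and> (\<forall>i<n. (T ^\<^sub>m a) $$ (i, i) = (T $$ (i, i)) ^ a)"
proof (induction a)
  case 0
  then show ?case using T by auto
next
  case (Suc a)
  have Ta: "T ^\<^sub>m a \<in> carrier_mat n n"
    using T by simp
  have entry: "(T ^\<^sub>m Suc a) $$ (i, j) = (\<Sum>l<n. (T ^\<^sub>m a) $$ (i, l) * T $$ (l, j))"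
    if "i < n" "j < n" for i j
    using T Ta that by (simp add: scalar_prod_def lessThan_atLeast0)
  have zero: "(T ^\<^sub>m a) $$ (i, l) * T $$ (l, j) = 0" if "i < n" "l < n" "l < i \<or> j < l" for i j l
    using that ut Suc.IH T Ta upper_triangularD[of T j l] upper_triangularD[of "T ^\<^sub>m a" l i] by auto
  have "(T ^\<^sub>m Suc a) $$ (i, j) = 0" if "j < i" "i < n" for i j
  proof -
    have "(T ^\<^sub>m a) $$ (i, l) * T $$ (l, j) = 0" if "l < n" for l
      using zero[of i l j] \<open>j < i\<close> \<open>i < n\<close> that by linarith
    then show ?thesis
      using that by (subst entry) auto
  qed
  moreover have "(T ^\<^sub>m Suc a) $$ (i, i) = (T $$ (i, i)) ^ Suc a" if "i < n" for i
  proof -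
    have "(\<Sum>l<n. (T ^\<^sub>m a) $$ (i, l) * T $$ (l, i)) = (\<Sum>l\<in>{i}. (T ^\<^sub>m a) $$ (i, l) * T $$ (l, i))"
      using that zero[of i _ i] by (intro sum.mono_neutral_right) (auto, metis linorder_neqE_nat)
    then show ?thesis
      using that Suc.IH entry[of i i] by (simp add: mult.commute)
  qed
  ultimately show ?case
    using T by auto
qed

text \<open>Schur triangularisation writes \<open>M\<close> as \<open>P T Q\<close> with
  \<open>Q P = 1\<close>. The trace is cyclic, the diagonal of a power of \<open>T\<close> consists
  of the powers of its diagonal, and that diagonal lists the roots of the characteristic polynomial
  with multiplicity. This covers matrices that are not normal, such as the centered product.\<close>

lemma mat_trace_pow:
  assumes M: "M \<in> carrier_mat n n"
  shows "mat_trace (M ^\<^sub>m a) = (\<Sum>z\<in>#eigs M. z ^ a)"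
proof -
  obtain es where es: "char_poly M = (\<Prod>e\<leftarrow>es. [:- e, 1:])" "length es = n"
    using char_poly_factorized[OF M] by blast
  obtain T P Q where "schur_decomposition M es = (T, P, Q)"
    by (metis prod_cases3)
  from schur_decomposition[OF M es(1) this]
  have wit: "similar_mat_wit M T P Q" and ut: "upper_triangular T" and diag: "diag_mat T = es"
    by auto
  note W = similar_mat_witD2[OF M wit]
  have "proots (\<Prod>e\<leftarrow>xs. [:- e, 1:]) = mset xs" for xs :: "complex list"
  proof (induction xs)
    case (Cons x xs)
    then show ?case
      by (subst list.map, subst prod_list.Cons, subst proots_mult) (auto simp: prod_list_zero_iff)
  qed simp
  then have eigs: "eigs M = mset es"
    by (simp add: eigs_def es)
  have Ta: "T ^\<^sub>m a \<in> carrier_mat n n"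
    using W by simp
  have "mat_trace (M ^\<^sub>m a) = mat_trace (P * (T ^\<^sub>m a) * Q)"
    using similar_mat_wit_pow_id[OF wit] by simp
  also have "\<dots> = mat_trace (Q * (P * T ^\<^sub>m a))"
    using W Ta by (intro mat_trace_mult_commute) auto
  also have "Q * (P * T ^\<^sub>m a) = (Q * P) * T ^\<^sub>m a"
    using W Ta by (intro assoc_mult_mat[symmetric]) auto
  also have "\<dots> = T ^\<^sub>m a"
    using W Ta by simp
  also have "mat_trace (T ^\<^sub>m a) = (\<Sum>i<n. (T $$ (i, i)) ^ a)"
    using upper_triangular_pow_mat[OF W(5) ut, of a] W(5) Ta by (simp add: mat_trace_def)
  also have "\<dots> = (\<Sum>z\<in>#mset es. z ^ a)"
  proof -
    have "(\<Sum>z\<in>#mset es. z ^ a) = sum_list (map (\<lambda>z. z ^ a) es)"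
      by (simp flip: sum_mset_sum_list)
    also have "\<dots> = (\<Sum>i<n. (T $$ (i, i)) ^ a)"
      using W(5) unfolding diag[symmetric]
      by (simp add: diag_mat_def comp_def interv_sum_list_conv_sum_set_nat lessThan_atLeast0)
    finally show ?thesis
      by simp
  qed
  finally show ?thesis
    by (simp add: eigs)
qed

lemma size_eigs: "M \<in> carrier_mat n n \<Longrightarrow> size (eigs M) = n"
  by (simp add: eigs_def size_proots_complex degree_monic_char_poly)

lemma set_eigs:
  assumes M: "M \<in> carrier_mat n n"
  shows "set_mset (eigs M) = {z. \<exists>v. v \<in> carrier_vec n \<and> v \<noteq> 0\<^sub>v n \<and> M *\<^sub>v v = z \<cdot>\<^sub>v v}"
proof -
  have "char_poly M \<noteq> 0"
    using degree_monic_char_poly[OF M] by auto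
  then have "set_mset (eigs M) = {z. eigenvalue M z}"
    by (simp add: eigs_def eigenvalue_root_char_poly[OF M])
  then show ?thesis
    using M by (auto simp: eigenvalue_def eigenvector_def)
qed

subsection \<open>The operator norm\<close>

lemma pow_mat_add:
  fixes A :: "'a :: semiring_1 mat"
  assumes A: "A \<in> carrier_mat n n"
  shows "A ^\<^sub>m (a + b) = A ^\<^sub>m a * A ^\<^sub>m b"
proof (induction b)
  case 0
  then show ?case using A by simp
next
  case (Suc b)
  then show ?case
    using A by (simp add: assoc_mult_mat[of "A ^\<^sub>m a" n n "A ^\<^sub>m b" n A n])
qed

lemma hermitian_mat_pow:
  assumes H: "hermitian_mat n H"
  shows "hermitian_mat n (H ^\<^sub>m a)"
proof (induction a)
  case 0
  then show ?case
    using H unfolding hermitian_mat_def by auto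
next
  case (Suc a)
  have Hc: "H \<in> carrier_mat n n" and Ha: "H ^\<^sub>m a \<in> carrier_mat n n"
    using H unfolding hermitian_mat_def by auto
  have "(H ^\<^sub>m Suc a) $$ (j, i) = cnj ((H ^\<^sub>m Suc a) $$ (i, j))" if ij: "i < n" "j < n" for i j
  proof -
    have "(H ^\<^sub>m Suc a) $$ (j, i) = (\<Sum>l<n. (H ^\<^sub>m a) $$ (j, l) * H $$ (l, i))"
      using mult_mat_index_sum[OF Ha Hc ij(2,1)] by simp
    also have "\<dots> = (\<Sum>l<n. cnj (H $$ (i, l) * (H ^\<^sub>m a) $$ (l, j)))"
    proof (intro sum.cong refl)
      fix l assume "l \<in> {..<n}"
      then have "(H ^\<^sub>m a) $$ (j, l) = cnj ((H ^\<^sub>m a) $$ (l, j))" "H $$ (l, i) = cnj (H $$ (i, l))"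
        using H Suc.IH ij unfolding hermitian_mat_def by blast+
      then show "(H ^\<^sub>m a) $$ (j, l) * H $$ (l, i) = cnj (H $$ (i, l) * (H ^\<^sub>m a) $$ (l, j))"
        by simp
    qed
    also have "\<dots> = cnj ((H * H ^\<^sub>m a) $$ (i, j))"
      using mult_mat_index_sum[OF Hc Ha ij] by simp
    also have "H * H ^\<^sub>m a = H ^\<^sub>m Suc a"
      using pow_mat_add[OF Hc, of 1 a] Hc by simp
    finally show ?thesis .
  qed
  then show ?case
    using Hc unfolding hermitian_mat_def by (meson pow_carrier_mat)
qed

lemma hermitian_mat_sandwich:
  assumes A: "hermitian_mat n A" and B: "hermitian_mat n B"
  shows "hermitian_mat n (B * A * B)"
proof -
  have Ac: "A \<in> carrier_mat n n" and Bc: "B \<in> carrier_mat n n"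
    using A B unfolding hermitian_mat_def by auto
  have expand: "(B * A * B) $$ (i, j) = (\<Sum>m<n. \<Sum>l<n. B $$ (i, l) * A $$ (l, m) * B $$ (m, j))"
    if "i < n" "j < n" for i j
    using Ac Bc that mult_mat_index_sum[of "B * A" n n B n i j]
    by (simp add: mult_mat_index_sum[OF Bc Ac] sum_distrib_right del: index_mult_mat(1))
  have "(B * A * B) $$ (j, i) = cnj ((B * A * B) $$ (i, j))" if ij: "i < n" "j < n" for i j
  proof -
    have "(B * A * B) $$ (j, i) = (\<Sum>l<n. \<Sum>m<n. B $$ (j, l) * A $$ (l, m) * B $$ (m, i))"
      unfolding expand[OF ij(2,1)] by (rule sum.swap)
    also have "\<dots> = (\<Sum>l<n. \<Sum>m<n. cnj (B $$ (i, m) * A $$ (m, l) * B $$ (l, j)))"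
    proof (intro sum.cong refl)
      fix l m assume "l \<in> {..<n}" "m \<in> {..<n}"
      then have "B $$ (j, l) = cnj (B $$ (l, j))" "A $$ (l, m) = cnj (A $$ (m, l))"
        "B $$ (m, i) = cnj (B $$ (i, m))"
        using A B ij unfolding hermitian_mat_def by blast+
      then show "B $$ (j, l) * A $$ (l, m) * B $$ (m, i)
          = cnj (B $$ (i, m) * A $$ (m, l) * B $$ (l, j))"
        by simp
    qed
    also have "\<dots> = cnj ((B * A * B) $$ (i, j))"
      using expand[OF ij] by simp
    finally show ?thesis .
  qed
  then show ?thesis
    using Ac Bc unfolding hermitian_mat_def by (meson mult_carrier_mat)
qed

lemma hermitian_mat_trace_square:
  assumes H: "hermitian_mat n H"
  shows "Re (mat_trace (H * H)) = (\<Sum>i<n. \<Sum>j<n. (cmod (H $$ (i, j)))\<^sup>2)"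
proof -
  have Hc: "H \<in> carrier_mat n n"
    using H unfolding hermitian_mat_def by auto
  have "mat_trace (H * H) = (\<Sum>i<n. \<Sum>j<n. H $$ (i, j) * H $$ (j, i))"
    using Hc by (simp add: mat_trace_def mult_mat_index_sum[OF Hc Hc] del: index_mult_mat(1))
  also have "\<dots> = (\<Sum>i<n. \<Sum>j<n. complex_of_real ((cmod (H $$ (i, j)))\<^sup>2))"
  proof (intro sum.cong refl)
    fix i j assume "i \<in> {..<n}" "j \<in> {..<n}"
    then have "H $$ (j, i) = cnj (H $$ (i, j))"
      using H unfolding hermitian_mat_def by blast
    then show "H $$ (i, j) * H $$ (j, i) = complex_of_real ((cmod (H $$ (i, j)))\<^sup>2)"
      by (simp only: complex_norm_square)
  qed
  finally show ?thesis
    by (simp del: of_real_power)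
qed

lemma vec_norm_mult_le_Frobenius:
  assumes H: "H \<in> carrier_mat m n" and x: "x \<in> carrier_vec n"
  shows "(vec_norm (H *\<^sub>v x))\<^sup>2 \<le> (\<Sum>i<m. \<Sum>j<n. (cmod (H $$ (i, j)))\<^sup>2) * (vec_norm x)\<^sup>2"
proof -
  have entry: "(cmod ((H *\<^sub>v x) $ i))\<^sup>2 \<le> (\<Sum>j<n. (cmod (H $$ (i, j)))\<^sup>2) * (vec_norm x)\<^sup>2"
    if i: "i < m" for i
  proof -
    have "cmod ((H *\<^sub>v x) $ i) \<le> (\<Sum>j<n. \<bar>cmod (H $$ (i, j))\<bar> * \<bar>cmod (x $ j)\<bar>)"
      unfolding mult_mat_vec_index_sum[OF H x i]
      by (rule order_trans[OF norm_sum]) (simp add: norm_mult)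
    also have "\<dots> \<le> L2_set (\<lambda>j. cmod (H $$ (i, j))) {..<n} * L2_set (\<lambda>j. cmod (x $ j)) {..<n}"
      by (rule L2_set_mult_ineq)
    finally have "(cmod ((H *\<^sub>v x) $ i))\<^sup>2
        \<le> (L2_set (\<lambda>j. cmod (H $$ (i, j))) {..<n} * L2_set (\<lambda>j. cmod (x $ j)) {..<n})\<^sup>2"
      by (intro power_mono) auto
    then show ?thesis
      using x by (simp add: L2_set_def vec_norm_def power_mult_distrib sum_nonneg)
  qed
  have "(vec_norm (H *\<^sub>v x))\<^sup>2 = (\<Sum>i<m. (cmod ((H *\<^sub>v x) $ i))\<^sup>2)"
    using H by (simp add: vec_norm_def sum_nonneg del: index_mult_mat_vec)
  also have "\<dots> \<le> (\<Sum>i<m. (\<Sum>j<n. (cmod (H $$ (i, j)))\<^sup>2) * (vec_norm x)\<^sup>2)"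
    by (intro sum_mono entry) auto
  finally show ?thesis
    by (simp add: sum_distrib_right)
qed

lemma Re_sum_mset: "Re (\<Sum>z\<in>#M. f z) = (\<Sum>z\<in>#M. Re (f z))"
  by (induction M) auto

text \<open>Diagonalisation is bypassed. With \<open>c\<close> the ratio of
  \<open>vec_norm (H *\<^sub>v x)\<close> to \<open>vec_norm x\<close>, repeated squaring bounds
  \<open>c ^ (2 ^ j)\<close> by the corresponding ratio for \<open>H ^\<^sub>m (2 ^ j)\<close>. The
  squared Frobenius norm of that power is a trace, hence at most \<open>n\<close> times the squared
  power of \<open>t\<close>. The factor \<open>n\<close> does not depend on \<open>j\<close>, so it
  cannot compensate for \<open>c / t > 1\<close> as \<open>j\<close> grows.\<close>

lemma hermitian_mat_vec_norm_le:
  assumes H: "hermitian_mat n H" and t: "0 \<le> t" "\<And>z. z \<in># eigs H \<Longrightarrow> cmod z \<le> t"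
    and x: "x \<in> carrier_vec n"
  shows "vec_norm (H *\<^sub>v x) \<le> t * vec_norm x"
proof (cases "vec_norm x = 0")
  case True
  have "H \<in> carrier_mat n n"
    using H unfolding hermitian_mat_def by auto
  then show ?thesis
    using vec_norm_mult_le_Frobenius[OF _ x, of H n] True by simp
next
  case False
  then have pos: "0 < vec_norm x"
    by (simp add: less_le)
  have Hc: "H \<in> carrier_mat n n"
    using H unfolding hermitian_mat_def by auto
  define c where "c = vec_norm (H *\<^sub>v x) / vec_norm x"
  have c0: "0 \<le> c"
    by (simp add: c_def)
  \<comment> \<open>Repeated squaring: \<open>\<parallel>K x\<parallel>\<^sup>2 = \<langle>K\<^sup>2 x, x\<rangle> \<le> \<parallel>K\<^sup>2 x\<parallel> \<parallel>x\<parallel>\<close>.\<close>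
  have lower: "c ^ (2 ^ j) * vec_norm x \<le> vec_norm (H ^\<^sub>m (2 ^ j) *\<^sub>v x)" for j
  proof (induction j)
    case 0
    then show ?case
      using pos Hc by (simp add: c_def)
  next
    case (Suc j)
    let ?K = "H ^\<^sub>m (2 ^ j)"
    have K: "hermitian_mat n ?K" "?K \<in> carrier_mat n n"
      using hermitian_mat_pow[OF H] Hc by auto
    have KK: "H ^\<^sub>m (2 ^ Suc j) *\<^sub>v x = ?K *\<^sub>v (?K *\<^sub>v x)"
      using pow_mat_add[OF Hc, of "2 ^ j" "2 ^ j"] K x by (simp add: mult_2)
    have "(vec_norm (?K *\<^sub>v x))\<^sup>2 = cmod ((?K *\<^sub>v x) \<bullet>c (?K *\<^sub>v x))"
      using K x by (subst cscalar_prod_self[where n = n]) (auto simp: norm_power)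
    also have "\<dots> = cmod ((?K *\<^sub>v (?K *\<^sub>v x)) \<bullet>c x)"
      using K x by (subst hermitian_mat_adjoint[OF K(1)]) auto
    also have "\<dots> \<le> vec_norm (H ^\<^sub>m (2 ^ Suc j) *\<^sub>v x) * vec_norm x"
      unfolding KK using K x by (intro cscalar_prod_Cauchy_Schwarz[where n = n]) auto
    finally have "(vec_norm (?K *\<^sub>v x))\<^sup>2 \<le> vec_norm (H ^\<^sub>m (2 ^ Suc j) *\<^sub>v x) * vec_norm x" .
    moreover have "(c ^ (2 ^ j) * vec_norm x)\<^sup>2 \<le> (vec_norm (?K *\<^sub>v x))\<^sup>2"
      using Suc.IH c0 by (intro power_mono) auto
    ultimately have "(c ^ (2 ^ Suc j) * vec_norm x) * vec_norm x
        \<le> vec_norm (H ^\<^sub>m (2 ^ Suc j) *\<^sub>v x) * vec_norm x"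
      by (simp add: power_mult_distrib power2_eq_square power_add mult_2 ac_simps)
    then show ?case
      using pos by (simp only: mult_le_cancel_right_pos)
  qed
  have upper: "(vec_norm (H ^\<^sub>m m *\<^sub>v x))\<^sup>2 \<le> real n * t ^ (2 * m) * (vec_norm x)\<^sup>2" for m
  proof -
    have "(vec_norm (H ^\<^sub>m m *\<^sub>v x))\<^sup>2 \<le> Re (mat_trace (H ^\<^sub>m m * H ^\<^sub>m m)) * (vec_norm x)\<^sup>2"
      using vec_norm_mult_le_Frobenius[of "H ^\<^sub>m m" n n x] hermitian_mat_pow[OF H] Hc x
      by (subst hermitian_mat_trace_square[where n = n]) auto
    also have "mat_trace (H ^\<^sub>m m * H ^\<^sub>m m) = (\<Sum>z\<in>#eigs H. z ^ (2 * m))"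
      using pow_mat_add[OF Hc, of m m] mat_trace_pow[OF Hc, of "m + m"] by (simp add: mult_2)
    also have "Re (\<Sum>z\<in>#eigs H. z ^ (2 * m)) \<le> (\<Sum>z\<in>#eigs H. t ^ (2 * m))"
    proof -
      have "Re (\<Sum>z\<in>#eigs H. z ^ (2 * m)) = (\<Sum>z\<in>#eigs H. Re (z ^ (2 * m)))"
        by (rule Re_sum_mset)
      also have "\<dots> \<le> (\<Sum>z\<in>#eigs H. t ^ (2 * m))"
      proof (rule sum_mset_mono)
        fix z assume "z \<in># eigs H"
        then have "cmod (z ^ (2 * m)) \<le> t ^ (2 * m)"
          unfolding norm_power by (intro power_mono t) auto
        then show "Re (z ^ (2 * m)) \<le> t ^ (2 * m)"
          using complex_Re_le_cmod order_trans by blast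
      qed
      finally show ?thesis .
    qed
    finally show ?thesis
      using size_eigs[OF Hc] by (simp add: mult_right_mono)
  qed
  have bound: "(c ^ (2 ^ j))\<^sup>2 \<le> real n * (t ^ (2 ^ j))\<^sup>2" for j
  proof -
    have "(c ^ (2 ^ j) * vec_norm x)\<^sup>2 \<le> (vec_norm (H ^\<^sub>m (2 ^ j) *\<^sub>v x))\<^sup>2"
      using lower c0 by (intro power_mono) auto
    then have "(c ^ (2 ^ j))\<^sup>2 * (vec_norm x)\<^sup>2 \<le> real n * (t ^ (2 ^ j))\<^sup>2 * (vec_norm x)\<^sup>2"
      using upper[of "2 ^ j"] by (simp add: power_mult_distrib mult.commute flip: power_mult)
    then show ?thesis
      using pos by simp
  qed
  have "c \<le> t"
  proof (rule ccontr)
    assume "\<not> c \<le> t"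
    then have ct: "t < c"
      by simp
    show False
    proof (cases "t = 0")
      case True
      then show False
        using bound[of 0] ct by simp
    next
      case False
      then have t0: "0 < t" and q: "1 < c / t"
        using t ct by auto
      obtain j where j: "real n < (c / t) ^ j"
        using real_arch_pow[OF q] by blast
      have jj: "j \<le> 2 ^ j * 2"
        using less_exp[of j] by linarith
      have "(c / t) ^ j \<le> (c / t) ^ (2 ^ j * 2)"
        by (rule power_increasing) (use q jj in auto)
      also have "\<dots> = (c ^ (2 ^ j))\<^sup>2 / (t ^ (2 ^ j))\<^sup>2"
        by (simp add: power_divide flip: power_mult)
      also have "\<dots> \<le> real n"
        using bound[of j] t0 by (simp add: divide_le_eq)
      finally show False
        using j by simp
    qed
  qed
  then show ?thesis
    using pos by (simp add: c_def divide_le_eq)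
qed

section \<open>The spectrum of \<open>A B A\<close> and the norm of \<open>A B\<close> for
  orthogonal projections\<close>

lemma orth_projD:
  assumes "orth_proj n A"
  shows "A \<in> carrier_mat n n" "hermitian_mat n A" "A * A = A"
  using assms orth_proj_iff_hermitian[of n A] unfolding orth_proj_def by blast+

lemma sandwich_mult_vec:
  assumes "A \<in> carrier_mat n n" "B \<in> carrier_mat n n" "v \<in> carrier_vec n"
  shows "(A * B * A) *\<^sub>v v = A *\<^sub>v (B *\<^sub>v (A *\<^sub>v v))"
  using assms by (metis assoc_mult_mat_vec mult_carrier_mat mult_mat_vec_carrier)

text \<open>Pair the eigenvalue equation with \<open>v\<close> and move the outer \<open>A\<close>
  to the other side: what remains is \<open>B\<close> applied to \<open>A v\<close>, paired with
  \<open>A v\<close>, which is a squared norm because \<open>B\<close> is a projection. The bound by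
  1 holds because both projections are contractions.\<close>

lemma sandwich_eigenvalue:
  assumes A: "orth_proj n A" and B: "orth_proj n B"
    and v: "v \<in> carrier_vec n" "v \<noteq> 0\<^sub>v n" "(A * B * A) *\<^sub>v v = z \<cdot>\<^sub>v v"
  shows "z = complex_of_real ((vec_norm (B *\<^sub>v (A *\<^sub>v v)))\<^sup>2 / (vec_norm v)\<^sup>2)"
    and "(vec_norm (B *\<^sub>v (A *\<^sub>v v)))\<^sup>2 / (vec_norm v)\<^sup>2 \<le> 1"
proof -
  note Ac = orth_projD[OF A] and Bc = orth_projD[OF B]
  have Av: "A *\<^sub>v v \<in> carrier_vec n" and BAv: "B *\<^sub>v (A *\<^sub>v v) \<in> carrier_vec n"
    using Ac Bc v by auto
  have pos: "0 < vec_norm v"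
    using v vec_norm_pos by blast
  have "z * complex_of_real ((vec_norm v)\<^sup>2) = (z \<cdot>\<^sub>v v) \<bullet>c v"
    unfolding cscalar_prod_self[OF v(1), symmetric]
    using v by (intro smult_scalar_prod_distrib[symmetric]) auto
  also have "\<dots> = (A *\<^sub>v (B *\<^sub>v (A *\<^sub>v v))) \<bullet>c v"
    using v sandwich_mult_vec[OF Ac(1) Bc(1) v(1)] by simp
  also have "\<dots> = (B *\<^sub>v (A *\<^sub>v v)) \<bullet>c (A *\<^sub>v v)"
    using Ac BAv v by (intro hermitian_mat_adjoint)
  also have "\<dots> = complex_of_real ((vec_norm (B *\<^sub>v (A *\<^sub>v v)))\<^sup>2)"
    using B Av by (rule orth_proj_cscalar_prod_self)
  finally show "z = complex_of_real ((vec_norm (B *\<^sub>v (A *\<^sub>v v)))\<^sup>2 / (vec_norm v)\<^sup>2)"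
    using pos by (simp add: field_simps)
  have "vec_norm (B *\<^sub>v (A *\<^sub>v v)) \<le> vec_norm v"
    using orth_proj_vec_norm_le[OF B Av] orth_proj_vec_norm_le[OF A v(1)] by linarith
  then show "(vec_norm (B *\<^sub>v (A *\<^sub>v v)))\<^sup>2 / (vec_norm v)\<^sup>2 \<le> 1"
    using pos by (simp add: divide_le_eq power_mono)
qed

lemma eigs_sandwich:
  assumes A: "orth_proj n A" and B: "orth_proj n B" and z: "z \<in># eigs (A * B * A)"
  shows "z = complex_of_real (Re z)" "0 \<le> Re z" "Re z \<le> 1"
proof -
  have "A * B * A \<in> carrier_mat n n"
    using orth_projD[OF A] orth_projD[OF B] by auto
  from set_eigs[OF this] z obtain v where
    v: "v \<in> carrier_vec n" "v \<noteq> 0\<^sub>v n" "(A * B * A) *\<^sub>v v = z \<cdot>\<^sub>v v"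
    by auto
  note E = sandwich_eigenvalue[OF A B v]
  show "z = complex_of_real (Re z)" "0 \<le> Re z" "Re z \<le> 1"
    using E(2) by (subst E(1), simp)+
qed

text \<open>The map taking \<open>v\<close> to \<open>A B v\<close> sends eigenvectors of
  \<open>B A B\<close> to eigenvectors of \<open>A B A\<close>; the image is not zero because
  applying \<open>B\<close> to it returns \<open>z v\<close>.\<close>

lemma eigs_sandwich_swap:
  assumes A: "orth_proj n A" and B: "orth_proj n B" and z: "z \<in># eigs (B * A * B)" "z \<noteq> 0"
  shows "z \<in># eigs (A * B * A)"
proof -
  note Ac = orth_projD[OF A] and Bc = orth_projD[OF B]
  have "B * A * B \<in> carrier_mat n n" and C: "A * B * A \<in> carrier_mat n n"
    using Ac Bc by auto
  from set_eigs[OF this(1)] z obtain v where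
    v: "v \<in> carrier_vec n" "v \<noteq> 0\<^sub>v n" "(B * A * B) *\<^sub>v v = z \<cdot>\<^sub>v v"
    by auto
  have BABv: "B *\<^sub>v (A *\<^sub>v (B *\<^sub>v v)) = z \<cdot>\<^sub>v v"
    using v sandwich_mult_vec[OF Bc(1) Ac(1) v(1)] by simp
  let ?u = "A *\<^sub>v (B *\<^sub>v v)"
  have u: "?u \<in> carrier_vec n"
    using Ac Bc v by auto
  have "?u \<noteq> 0\<^sub>v n"
  proof
    assume "?u = 0\<^sub>v n"
    moreover have "B *\<^sub>v 0\<^sub>v n = 0\<^sub>v n"
      using Bc(1) by auto
    ultimately have "z \<cdot>\<^sub>v v = 0\<^sub>v n"
      using BABv by simp
    then have "cmod z * vec_norm v = 0"
      unfolding vec_norm_smult[symmetric] by (simp add: vec_norm_def)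
    then show False
      using z vec_norm_pos[OF v(1,2)] by simp
  qed
  moreover have "(A * B * A) *\<^sub>v ?u = z \<cdot>\<^sub>v ?u"
  proof -
    have "(A * B * A) *\<^sub>v ?u = A *\<^sub>v (B *\<^sub>v ?u)"
      using Ac Bc v u by (subst sandwich_mult_vec) (auto simp: orth_proj_idem_vec[OF A])
    also have "\<dots> = A *\<^sub>v (B *\<^sub>v (B *\<^sub>v ?u))"
      using u by (simp add: orth_proj_idem_vec[OF B])
    also have "\<dots> = A *\<^sub>v (z \<cdot>\<^sub>v (B *\<^sub>v v))"
      unfolding BABv using Bc v by (simp add: mult_mat_vec)
    also have "\<dots> = z \<cdot>\<^sub>v ?u"
      using Ac Bc v by (subst mult_mat_vec[of A n n]) auto
    finally show ?thesis .
  qed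
  ultimately show ?thesis
    using set_eigs[OF C] u by blast
qed

lemma lambda_max_sandwich:
  assumes A: "orth_proj n A" and B: "orth_proj n B" and n: "0 < n"
  shows "complex_of_real (lambda_max (A * B * A)) \<in># eigs (A * B * A)"
    and "z \<in># eigs (A * B * A) \<Longrightarrow> Re z \<le> lambda_max (A * B * A)"
    and "0 \<le> lambda_max (A * B * A)" "lambda_max (A * B * A) \<le> 1"
proof -
  have C: "A * B * A \<in> carrier_mat n n"
    using orth_projD[OF A] orth_projD[OF B] by auto
  have ne: "Re ` set_mset (eigs (A * B * A)) \<noteq> {}"
    using size_eigs[OF C] n by auto
  from Max_in[OF _ ne] obtain w where
    w: "w \<in># eigs (A * B * A)" "lambda_max (A * B * A) = Re w"
    by (auto simp: lambda_max_def)
  note E = eigs_sandwich[OF A B w(1)]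
  show "complex_of_real (lambda_max (A * B * A)) \<in># eigs (A * B * A)"
    using w E(1) by simp
  show "0 \<le> lambda_max (A * B * A)" "lambda_max (A * B * A) \<le> 1"
    using w E by auto
  show "z \<in># eigs (A * B * A) \<Longrightarrow> Re z \<le> lambda_max (A * B * A)"
    by (auto simp: lambda_max_def intro: Max_ge)
qed

text \<open>The squared norm of \<open>A B x\<close> is the pairing of \<open>B A B x\<close> with
  \<open>x\<close>. Its upper bound therefore comes from the spectral bound for the Hermitian matrix
  \<open>B A B\<close>, whose nonzero eigenvalues are eigenvalues of \<open>A B A\<close>.\<close>

lemma op_norm_proj_product:
  assumes A: "orth_proj n A" and B: "orth_proj n B" and n: "0 < n"
  shows "(op_norm (A * B))\<^sup>2 = lambda_max (A * B * A)"
proof -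
  note Ac = orth_projD[OF A] and Bc = orth_projD[OF B]
  define L where "L = lambda_max (A * B * A)"
  note L = lambda_max_sandwich[OF A B n, folded L_def]
  have AB: "(A * B) *\<^sub>v x = A *\<^sub>v (B *\<^sub>v x)" if "x \<in> carrier_vec n" for x
    using Ac Bc that by simp
  have le: "(vec_norm ((A * B) *\<^sub>v x))\<^sup>2 \<le> L * (vec_norm x)\<^sup>2" if x: "x \<in> carrier_vec n" for x
  proof -
    have Bx: "B *\<^sub>v x \<in> carrier_vec n" and ABx: "A *\<^sub>v (B *\<^sub>v x) \<in> carrier_vec n"
      and BABx: "B *\<^sub>v (A *\<^sub>v (B *\<^sub>v x)) \<in> carrier_vec n"
      using Ac Bc x by auto
    have "complex_of_real ((vec_norm (A *\<^sub>v (B *\<^sub>v x)))\<^sup>2) = (A *\<^sub>v (B *\<^sub>v x)) \<bullet>c (B *\<^sub>v x)"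
      using orth_proj_cscalar_prod_self[OF A Bx] by simp
    also have "\<dots> = (B *\<^sub>v (A *\<^sub>v (B *\<^sub>v x))) \<bullet>c x"
      using Bc ABx x by (intro hermitian_mat_adjoint[symmetric])
    finally have "(vec_norm (A *\<^sub>v (B *\<^sub>v x)))\<^sup>2 = cmod ((B *\<^sub>v (A *\<^sub>v (B *\<^sub>v x))) \<bullet>c x)"
      by (metis abs_power2 norm_of_real)
    also have "\<dots> \<le> vec_norm (B *\<^sub>v (A *\<^sub>v (B *\<^sub>v x))) * vec_norm x"
      using BABx x by (rule cscalar_prod_Cauchy_Schwarz)
    also have "B *\<^sub>v (A *\<^sub>v (B *\<^sub>v x)) = (B * A * B) *\<^sub>v x"
      using sandwich_mult_vec[OF Bc(1) Ac(1) x] by simp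
    also have "vec_norm ((B * A * B) *\<^sub>v x) \<le> L * vec_norm x"
    proof (rule hermitian_mat_vec_norm_le[OF hermitian_mat_sandwich[OF Ac(2) Bc(2)] L(3) _ x])
      fix z assume z: "z \<in># eigs (B * A * B)"
      note E = eigs_sandwich[OF B A z]
      have "Re z \<le> L"
        using eigs_sandwich_swap[OF A B z] L(2,3) by (cases "z = 0") auto
      then show "cmod z \<le> L"
        using E by (metis abs_of_nonneg norm_of_real)
    qed
    finally show ?thesis
      using x AB by (simp add: mult_right_mono power2_eq_square mult.assoc)
  qed
  \<comment> \<open>The supremum is attained: for \<open>L > 0\<close> at the normalised vector
    \<open>B A v\<close>, with \<open>v\<close> an eigenvector of \<open>A B A\<close> for
    \<open>L\<close>; for \<open>L = 0\<close> every unit vector satisfies the lower bound.\<close>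
  obtain x where x: "x \<in> carrier_vec n" "vec_norm x = 1" "L \<le> (vec_norm ((A * B) *\<^sub>v x))\<^sup>2"
  proof (cases "L = 0")
    case True
    have "(\<Sum>i<n. (cmod (unit_vec n 0 $ i))\<^sup>2) = (\<Sum>i\<in>{0}. (cmod (unit_vec n 0 $ i))\<^sup>2)"
      using n by (intro sum.mono_neutral_right) auto
    then have "vec_norm (unit_vec n 0 :: complex Matrix.vec) = 1"
      using n by (simp add: vec_norm_def)
    then show ?thesis
      using True that[of "unit_vec n 0"] by simp
  next
    case False
    then have L0: "0 < L"
      using L by simp
    have "A * B * A \<in> carrier_mat n n"
      using Ac Bc by auto
    from set_eigs[OF this] L(1) obtain v where
      v: "v \<in> carrier_vec n" "v \<noteq> 0\<^sub>v n" "(A * B * A) *\<^sub>v v = complex_of_real L \<cdot>\<^sub>v v"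
      by auto
    define u where "u = B *\<^sub>v (A *\<^sub>v v)"
    have u: "u \<in> carrier_vec n"
      using Ac Bc v by (simp add: u_def)
    have pos: "0 < vec_norm v"
      using v vec_norm_pos by blast
    have nu: "(vec_norm u)\<^sup>2 = L * (vec_norm v)\<^sup>2"
    proof -
      have "L = (vec_norm u)\<^sup>2 / (vec_norm v)\<^sup>2"
        using sandwich_eigenvalue(1)[OF A B v] unfolding u_def of_real_eq_iff .
      then show ?thesis
        using pos by simp
    qed
    then have u0: "0 < vec_norm u"
      using L0 pos by (metis less_le mult_pos_pos vec_norm_nonneg zero_less_power zero_power2)
    have "(A * B) *\<^sub>v u = complex_of_real L \<cdot>\<^sub>v v"
      using AB[OF u] v(3) sandwich_mult_vec[OF Ac(1) Bc(1) v(1)] orth_proj_idem_vec[OF B, of "A *\<^sub>v v"] Ac v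
      by (simp add: u_def)
    then have nABu: "vec_norm ((A * B) *\<^sub>v u) = L * vec_norm v"
      using L0 by (simp add: vec_norm_smult)
    define x where "x = complex_of_real (1 / vec_norm u) \<cdot>\<^sub>v u"
    have "(A * B) *\<^sub>v x = complex_of_real (1 / vec_norm u) \<cdot>\<^sub>v ((A * B) *\<^sub>v u)"
      unfolding x_def using Ac Bc u by (intro mult_mat_vec[of _ n n]) auto
    then have "(vec_norm ((A * B) *\<^sub>v x))\<^sup>2 = (L * vec_norm v)\<^sup>2 / (vec_norm u)\<^sup>2"
      using nABu by (simp add: vec_norm_smult power_divide norm_divide)
    also have "\<dots> = L"
      using nu pos L0 by (simp add: power_mult_distrib power2_eq_square)
    finally show ?thesis
      using u u0 that[of x] by (simp add: x_def vec_norm_smult norm_divide)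
  qed
  have "op_norm (A * B) = vec_norm ((A * B) *\<^sub>v x)"
    unfolding op_norm_def
  proof (rule cSup_eq_maximum)
    show "vec_norm ((A * B) *\<^sub>v x)
        \<in> {vec_norm ((A * B) *\<^sub>v x) |x. x \<in> carrier_vec (dim_col (A * B)) \<and> vec_norm x = 1}"
      using x Bc by auto
    fix y assume "y \<in> {vec_norm ((A * B) *\<^sub>v x) |x. x \<in> carrier_vec (dim_col (A * B)) \<and> vec_norm x = 1}"
    then obtain x' where x': "x' \<in> carrier_vec n" "vec_norm x' = 1" "y = vec_norm ((A * B) *\<^sub>v x')"
      using Bc by auto
    then have "y\<^sup>2 \<le> (vec_norm ((A * B) *\<^sub>v x))\<^sup>2"
      using le[OF x'(1)] x by (simp del: power_mono_iff)
    then show "y \<le> vec_norm ((A * B) *\<^sub>v x)"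
      by (rule power2_le_imp_le) simp
  qed
  then show ?thesis
    using le[OF x(1)] x by (simp add: L_def)
qed

subsection \<open>The spectrum of the centered product\<close>

definition centered_product :: "nat \<Rightarrow> real \<Rightarrow> real \<Rightarrow> complex mat \<Rightarrow> complex mat \<Rightarrow> complex mat" where
  "centered_product n \<alpha> \<beta> A B =
     (complex_of_real (1 / sqrt (\<alpha> * (1 - \<alpha>))) \<cdot>\<^sub>m (A - complex_of_real \<alpha> \<cdot>\<^sub>m 1\<^sub>m n)) *
     (complex_of_real (1 / sqrt (\<beta> * (1 - \<beta>))) \<cdot>\<^sub>m (B - complex_of_real \<beta> \<cdot>\<^sub>m 1\<^sub>m n))"

text \<open>This is the \<open>\<sigma>\<close> of the overview, the product of the two normalising
  constants: the centered product is \<open>(A - \<alpha>) (B - \<beta>)\<close> divided by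
  it.\<close>

definition spread :: "real \<Rightarrow> real \<Rightarrow> real" where
  "spread \<alpha> \<beta> = sqrt (\<alpha> * (1 - \<alpha>)) * sqrt (\<beta> * (1 - \<beta>))"

lemma spread_pos: "0 < \<alpha> \<Longrightarrow> \<alpha> < 1 \<Longrightarrow> 0 < \<beta> \<Longrightarrow> \<beta> < 1 \<Longrightarrow> 0 < spread \<alpha> \<beta>"
  by (simp add: spread_def)

lemma spread_square:
  "0 < \<alpha> \<Longrightarrow> \<alpha> < 1 \<Longrightarrow> 0 < \<beta> \<Longrightarrow> \<beta> < 1 \<Longrightarrow> (spread \<alpha> \<beta>)\<^sup>2 = \<alpha> * (1 - \<alpha>) * (\<beta> * (1 - \<beta>))"
  by (simp add: spread_def power_mult_distrib)

text \<open>In this form \<open>r_plus\<close> is visibly the value of \<open>l\<close> for which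
  \<open>(l - \<alpha> - \<beta> + 2 * \<alpha> * \<beta>) / spread \<alpha> \<beta>\<close>, the
  sum of a reciprocal pair of eigenvalues of the centered product, equals 2.\<close>

lemma r_plus_eq_spread:
  assumes "0 < \<alpha>" "\<alpha> < 1" "0 < \<beta>" "\<beta> < 1"
  shows "r_plus \<alpha> \<beta> = \<alpha> + \<beta> - 2 * \<alpha> * \<beta> + 2 * spread \<alpha> \<beta>"
proof -
  have "sqrt (\<alpha> * (1 - \<beta>)) * sqrt (\<beta> * (1 - \<alpha>)) = spread \<alpha> \<beta>"
    by (simp add: spread_def ac_simps flip: real_sqrt_mult)
  then show ?thesis
    using assms by (simp add: r_plus_def power2_sum mult.assoc) (simp add: algebra_simps)
qed

lemma centered_product_carrier:
  "A \<in> carrier_mat n n \<Longrightarrow> B \<in> carrier_mat n n \<Longrightarrow> centered_product n \<alpha> \<beta> A B \<in> carrier_mat n n"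
  unfolding centered_product_def by (intro mult_carrier_mat smult_carrier_mat minus_carrier_mat) auto

lemma shifted_mat_mult_vec_index:
  fixes A :: "complex mat"
  assumes "A \<in> carrier_mat n n" "v \<in> carrier_vec n" "i < n"
  shows "((c \<cdot>\<^sub>m (A - a \<cdot>\<^sub>m 1\<^sub>m n)) *\<^sub>v v) $ i = c * ((A *\<^sub>v v) $ i - a * v $ i)"
proof -
  have "((c \<cdot>\<^sub>m (A - a \<cdot>\<^sub>m 1\<^sub>m n)) *\<^sub>v v) $ i
      = (\<Sum>j<n. c * (A $$ (i, j) * v $ j) - (if i = j then c * a * v $ i else 0))"
    using assms
    by (subst mult_mat_vec_index_sum[where m = n and n = n])
       (auto intro!: sum.cong simp: algebra_simps)
  also have "\<dots> = c * ((A *\<^sub>v v) $ i - a * v $ i)"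
    using assms mult_mat_vec_index_sum[OF assms]
    by (simp add: sum_subtractf algebra_simps del: index_mult_mat_vec flip: sum_distrib_left)
  finally show ?thesis .
qed

text \<open>Four terms suffice throughout because \<open>(A - \<alpha>) (B - \<beta>)\<close>
  expands into multiples of \<open>A B\<close>, \<open>A\<close>, \<open>B\<close> and the identity.
  Shorter combinations are padded with zero multiples of \<open>v\<close>.\<close>

lemma mult_mat_vec_lincomb4:
  fixes A :: "complex mat"
  assumes "A \<in> carrier_mat n n" "u1 \<in> carrier_vec n" "u2 \<in> carrier_vec n" "u3 \<in> carrier_vec n"
    "u4 \<in> carrier_vec n"
    and "v = c1 \<cdot>\<^sub>v u1 + c2 \<cdot>\<^sub>v u2 + c3 \<cdot>\<^sub>v u3 + c4 \<cdot>\<^sub>v u4"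
  shows "A *\<^sub>v v = c1 \<cdot>\<^sub>v (A *\<^sub>v u1) + c2 \<cdot>\<^sub>v (A *\<^sub>v u2) + c3 \<cdot>\<^sub>v (A *\<^sub>v u3) + c4 \<cdot>\<^sub>v (A *\<^sub>v u4)"
proof -
  have C: "A *\<^sub>v u1 \<in> carrier_vec n" "A *\<^sub>v u2 \<in> carrier_vec n" "A *\<^sub>v u3 \<in> carrier_vec n"
    "A *\<^sub>v u4 \<in> carrier_vec n"
    using assms by auto
  show ?thesis
    unfolding assms(6) using assms(1-5) C
    by (simp add: mult_add_distrib_mat_vec[where nr = n and nc = n] mult_mat_vec[where nr = n and nc = n]
        assoc_add_vec[where n = n])
qed

lemma cscalar_prod_lincomb4:
  fixes u1 u2 u3 u4 w :: "complex Matrix.vec"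
  assumes "u1 \<in> carrier_vec n" "u2 \<in> carrier_vec n" "u3 \<in> carrier_vec n" "u4 \<in> carrier_vec n"
    "w \<in> carrier_vec n"
    and "v = c1 \<cdot>\<^sub>v u1 + c2 \<cdot>\<^sub>v u2 + c3 \<cdot>\<^sub>v u3 + c4 \<cdot>\<^sub>v u4"
  shows "v \<bullet>c w
    = c1 * (u1 \<bullet>c w) + c2 * (u2 \<bullet>c w) + c3 * (u3 \<bullet>c w) + c4 * (u4 \<bullet>c w)"
  using assms by (simp add: cscalar_prod_sum sum.distrib sum_distrib_left distrib_right mult.assoc)

lemma centered_product_mult_vec:
  assumes A: "A \<in> carrier_mat n n" and B: "B \<in> carrier_mat n n" and v: "v \<in> carrier_vec n"
    and i: "i < n"
  shows "(centered_product n \<alpha> \<beta> A B *\<^sub>v v) $ i = complex_of_real (1 / spread \<alpha> \<beta>) *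
    ((A *\<^sub>v (B *\<^sub>v v)) $ i - \<alpha> * (B *\<^sub>v v) $ i - \<beta> * (A *\<^sub>v v) $ i + complex_of_real (\<alpha> * \<beta>) * v $ i)"
proof -
  define s where "s = complex_of_real (1 / sqrt (\<beta> * (1 - \<beta>)))"
  define Y where "Y = s \<cdot>\<^sub>m (B - complex_of_real \<beta> \<cdot>\<^sub>m 1\<^sub>m n)"
  have Y: "Y \<in> carrier_mat n n"
    using B unfolding Y_def by (intro smult_carrier_mat minus_carrier_mat) auto
  have BvC: "B *\<^sub>v v \<in> carrier_vec n"
    using B v by simp
  have Yv: "Y *\<^sub>v v = s \<cdot>\<^sub>v (B *\<^sub>v v) + (- s * \<beta>) \<cdot>\<^sub>v v + 0 \<cdot>\<^sub>v v + 0 \<cdot>\<^sub>v v"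
  proof (rule eq_vecI)
    fix j assume "j < dim_vec (s \<cdot>\<^sub>v (B *\<^sub>v v) + (- s * \<beta>) \<cdot>\<^sub>v v + 0 \<cdot>\<^sub>v v + 0 \<cdot>\<^sub>v v)"
    then have j: "j < n"
      using v by simp
    show "(Y *\<^sub>v v) $ j = (s \<cdot>\<^sub>v (B *\<^sub>v v) + (- s * \<beta>) \<cdot>\<^sub>v v + 0 \<cdot>\<^sub>v v + 0 \<cdot>\<^sub>v v) $ j"
      using shifted_mat_mult_vec_index[OF B v j, of s \<beta>] B v j
      by (simp add: Y_def algebra_simps del: index_mult_mat_vec)
  qed (use Y v in auto)
  have YvC: "Y *\<^sub>v v \<in> carrier_vec n"
    using Y v by simp
  note AYv = mult_mat_vec_lincomb4[OF A BvC v v v Yv]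
  have "centered_product n \<alpha> \<beta> A B *\<^sub>v v =
      (complex_of_real (1 / sqrt (\<alpha> * (1 - \<alpha>))) \<cdot>\<^sub>m (A - complex_of_real \<alpha> \<cdot>\<^sub>m 1\<^sub>m n)) *\<^sub>v (Y *\<^sub>v v)"
    unfolding centered_product_def Y_def[symmetric] s_def[symmetric]
    using A Y v by (intro assoc_mult_mat_vec smult_carrier_mat minus_carrier_mat) auto
  then have "(centered_product n \<alpha> \<beta> A B *\<^sub>v v) $ i
      = complex_of_real (1 / sqrt (\<alpha> * (1 - \<alpha>))) * ((A *\<^sub>v (Y *\<^sub>v v)) $ i - \<alpha> * (Y *\<^sub>v v) $ i)"
    using shifted_mat_mult_vec_index[OF A YvC i] by simp
  also have "\<dots> = complex_of_real (1 / sqrt (\<alpha> * (1 - \<alpha>))) * s *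
    ((A *\<^sub>v (B *\<^sub>v v)) $ i - \<alpha> * (B *\<^sub>v v) $ i - \<beta> * (A *\<^sub>v v) $ i + complex_of_real (\<alpha> * \<beta>) * v $ i)"
    unfolding AYv unfolding Yv using A B v i by (simp add: algebra_simps del: index_mult_mat_vec)
  also have "complex_of_real (1 / sqrt (\<alpha> * (1 - \<alpha>))) * s = complex_of_real (1 / spread \<alpha> \<beta>)"
    by (simp add: s_def spread_def)
  finally show ?thesis .
qed

text \<open>In the notation of the overview, \<open>X\<close> has the inverse
  \<open>(A - (1 - \<alpha>)) / sqrt (\<alpha> * (1 - \<alpha>))\<close>, and \<open>Y\<close>
  likewise. The proof derives \<open>v = z M\<^sup>-\<^sup>1 v\<close> from \<open>M v = z v\<close>
  by applying these inverses, then pairs both equations with \<open>v\<close>. The pairing of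
  \<open>(M + M\<^sup>-\<^sup>1) v\<close> with \<open>v\<close> is real, so the imaginary parts
  cancel.\<close>

lemma centered_product_eigenvalue_real_or_unit:
  assumes A: "orth_proj n A" and B: "orth_proj n B"
    and \<alpha>: "0 < \<alpha>" "\<alpha> < 1" and \<beta>: "0 < \<beta>" "\<beta> < 1"
    and z: "z \<in># eigs (centered_product n \<alpha> \<beta> A B)"
  shows "Im z = 0 \<or> cmod z = 1"
proof -
  note Ac = orth_projD[OF A] and Bc = orth_projD[OF B]
  have M: "centered_product n \<alpha> \<beta> A B \<in> carrier_mat n n"
    using Ac Bc by (intro centered_product_carrier)
  from set_eigs[OF M] z obtain v where
    v: "v \<in> carrier_vec n" "v \<noteq> 0\<^sub>v n" "centered_product n \<alpha> \<beta> A B *\<^sub>v v = z \<cdot>\<^sub>v v"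
    by auto
  define s where "s = spread \<alpha> \<beta>"
  have s: "0 < s" "s\<^sup>2 = \<alpha> * (1 - \<alpha>) * (\<beta> * (1 - \<beta>))"
    using spread_pos[OF \<alpha> \<beta>] spread_square[OF \<alpha> \<beta>] by (auto simp: s_def)
  define a b ab ba where "a = A *\<^sub>v v" "b = B *\<^sub>v v" "ab = A *\<^sub>v b" "ba = B *\<^sub>v a"
  note defs = this
  have C: "a \<in> carrier_vec n" "b \<in> carrier_vec n" "ab \<in> carrier_vec n" "ba \<in> carrier_vec n"
    using Ac Bc v by (auto simp: defs)
  have idem: "A *\<^sub>v a = a" "A *\<^sub>v b = ab" "A *\<^sub>v ab = ab" "B *\<^sub>v b = b" "B *\<^sub>v a = ba"
    using C v orth_proj_idem_vec[OF A] orth_proj_idem_vec[OF B] by (auto simp: defs)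
  let ?\<alpha> = "complex_of_real \<alpha>" and ?\<beta> = "complex_of_real \<beta>" and ?s = "complex_of_real s"
  have E1: "(?s * z) \<cdot>\<^sub>v v = 1 \<cdot>\<^sub>v ab + (- ?\<alpha>) \<cdot>\<^sub>v b + (- ?\<beta>) \<cdot>\<^sub>v a + (?\<alpha> * ?\<beta>) \<cdot>\<^sub>v v" (is "_ = ?R")
  proof (rule eq_vecI)
    fix i assume "i < dim_vec ?R"
    then have i: "i < n"
      using v by simp
    have "z * v $ i = complex_of_real (1 / s) * (ab $ i - \<alpha> * b $ i - \<beta> * a $ i + \<alpha> * \<beta> * v $ i)"
      using centered_product_mult_vec[OF Ac(1) Bc(1) v(1) i, of \<alpha> \<beta>] v(1,3) i
      by (simp add: defs s_def)
    then have "?s * z * v $ i = ab $ i - \<alpha> * b $ i - \<beta> * a $ i + \<alpha> * \<beta> * v $ i"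
      using s by (simp add: field_simps)
    then show "((?s * z) \<cdot>\<^sub>v v) $ i = ?R $ i"
      using C v i by simp
  qed (use C v in auto)
  note E2 = mult_mat_vec_lincomb4[OF Ac(1) C(3,2,1) v(1) E1]
  have E1i: "?s * z * v $ i = ab $ i - ?\<alpha> * b $ i - ?\<beta> * a $ i + ?\<alpha> * ?\<beta> * v $ i" if "i < n" for i
    using arg_cong[OF E1, of "\<lambda>u. u $ i"] C v that by simp
  have E2i: "?s * z * a $ i = ab $ i - ?\<alpha> * ab $ i - ?\<beta> * a $ i + ?\<alpha> * ?\<beta> * a $ i" if "i < n" for i
    using arg_cong[OF E2, of "\<lambda>u. u $ i"] C v that Ac(1)
    by (simp add: mult_mat_vec[OF Ac(1)] idem flip: defs(1) del: index_mult_mat_vec)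
  \<comment> \<open>This is \<open>Y v = z X\<^sup>-\<^sup>1 v\<close> cleared of denominators. It
    arises as \<open>1 - \<alpha>\<close> times \<open>E1\<close> minus \<open>E2\<close>, in which
    the \<open>A B v\<close> terms and the \<open>\<beta> A v\<close> terms cancel.\<close>
  have E3i: "?\<alpha> * (1 - ?\<alpha>) * b $ i = ?s * z * a $ i - ?s * z * (1 - ?\<alpha>) * v $ i
      + ?\<alpha> * (1 - ?\<alpha>) * ?\<beta> * v $ i" if "i < n" for i
  proof -
    have "?\<alpha> * (1 - ?\<alpha>) * b $ i
        - (?s * z * a $ i - ?s * z * (1 - ?\<alpha>) * v $ i + ?\<alpha> * (1 - ?\<alpha>) * ?\<beta> * v $ i)
      = (1 - ?\<alpha>) * (?s * z * v $ i - (ab $ i - ?\<alpha> * b $ i - ?\<beta> * a $ i + ?\<alpha> * ?\<beta> * v $ i))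
        - (?s * z * a $ i - (ab $ i - ?\<alpha> * ab $ i - ?\<beta> * a $ i + ?\<alpha> * ?\<beta> * a $ i))"
      by (simp add: algebra_simps)
    then show ?thesis
      unfolding E1i[OF that, symmetric] E2i[OF that, symmetric] by simp
  qed
  have E3: "(?\<alpha> * (1 - ?\<alpha>)) \<cdot>\<^sub>v b = (?s * z) \<cdot>\<^sub>v a + (- (?s * z * (1 - ?\<alpha>))) \<cdot>\<^sub>v v
      + (?\<alpha> * (1 - ?\<alpha>) * ?\<beta>) \<cdot>\<^sub>v v + 0 \<cdot>\<^sub>v v"
    using C v E3i by (intro eq_vecI) auto
  note E4 = mult_mat_vec_lincomb4[OF Bc(1) C(1) v(1) v(1) v(1) E3]
  have E4i: "?\<alpha> * (1 - ?\<alpha>) * b $ i = ?s * z * ba $ i - ?s * z * (1 - ?\<alpha>) * b $ i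
      + ?\<alpha> * (1 - ?\<alpha>) * ?\<beta> * b $ i" if "i < n" for i
    using arg_cong[OF E4, of "\<lambda>u. u $ i"] C v that Bc(1)
    by (simp add: mult_mat_vec[OF Bc(1)] idem flip: defs(2) del: index_mult_mat_vec)
  have s2: "?s * ?s = ?\<alpha> * (1 - ?\<alpha>) * (?\<beta> * (1 - ?\<beta>))"
    using arg_cong[OF s(2), of complex_of_real] by (simp add: power2_eq_square)
  \<comment> \<open>Now \<open>v = z Y\<^sup>-\<^sup>1 X\<^sup>-\<^sup>1 v\<close>, scaled by
    \<open>s\<close> squared. It is \<open>E4\<close> minus \<open>1 - \<beta>\<close> times
    \<open>E3\<close>, that is, \<open>B - (1 - \<beta>)\<close> applied to \<open>E3\<close>; on
    the left \<open>(B - (1 - \<beta>)) (B - \<beta>)\<close> collapses to the scalar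
    \<open>\<beta> (1 - \<beta>)\<close>.\<close>
  have E5: "(?s * ?s) \<cdot>\<^sub>v v = (?s * z) \<cdot>\<^sub>v ba + (- (?s * z * (1 - ?\<beta>))) \<cdot>\<^sub>v a
      + (- (?s * z * (1 - ?\<alpha>))) \<cdot>\<^sub>v b + (?s * z * (1 - ?\<alpha>) * (1 - ?\<beta>)) \<cdot>\<^sub>v v" (is "_ = ?R")
  proof (rule eq_vecI)
    fix i assume "i < dim_vec ?R"
    then have i: "i < n"
      using v by simp
    have "?s * ?s * v $ i = ?s * z * ba $ i - ?s * z * (1 - ?\<beta>) * a $ i - ?s * z * (1 - ?\<alpha>) * b $ i
        + ?s * z * (1 - ?\<alpha>) * (1 - ?\<beta>) * v $ i"
    proof -
      have "?s * ?s * v $ i - (?s * z * ba $ i - ?s * z * (1 - ?\<beta>) * a $ i - ?s * z * (1 - ?\<alpha>) * b $ i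
          + ?s * z * (1 - ?\<alpha>) * (1 - ?\<beta>) * v $ i)
        = (?\<alpha> * (1 - ?\<alpha>) * b $ i - (?s * z * ba $ i - ?s * z * (1 - ?\<alpha>) * b $ i
            + ?\<alpha> * (1 - ?\<alpha>) * ?\<beta> * b $ i))
          - (1 - ?\<beta>) * (?\<alpha> * (1 - ?\<alpha>) * b $ i - (?s * z * a $ i - ?s * z * (1 - ?\<alpha>) * v $ i
            + ?\<alpha> * (1 - ?\<alpha>) * ?\<beta> * v $ i))"
        unfolding s2 by (simp add: algebra_simps)
      then show ?thesis
        unfolding E3i[OF i, symmetric] E4i[OF i, symmetric] by simp
    qed
    then show "((?s * ?s) \<cdot>\<^sub>v v) $ i = ?R $ i"
      using C v i by simp
  qed (use C v in auto)
  define p q w r where "p = (vec_norm a)\<^sup>2" "q = (vec_norm b)\<^sup>2" "w = (vec_norm v)\<^sup>2" "r = ab \<bullet>c v"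
  note pq = this
  have w: "0 < w"
    using vec_norm_pos[OF v(1,2)] by (simp add: pq)
  have ips: "a \<bullet>c v = complex_of_real p" "b \<bullet>c v = complex_of_real q" "v \<bullet>c v = complex_of_real w"
    using orth_proj_cscalar_prod_self[OF A v(1)] orth_proj_cscalar_prod_self[OF B v(1)]
      cscalar_prod_self[OF v(1)] by (auto simp: pq defs)
  have "ba \<bullet>c v = a \<bullet>c b"
    using hermitian_mat_adjoint[OF Bc(2) C(1) v(1)] by (simp add: defs)
  also have "\<dots> = cnj (b \<bullet>c a)"
    using C by (intro cscalar_prod_commute)
  also have "b \<bullet>c a = r"
    using hermitian_mat_adjoint[OF Ac(2) C(2) v(1)] by (simp add: pq defs)
  finally have ba: "ba \<bullet>c v = cnj r" .
  have I1: "?s * z * w = r - ?\<alpha> * q - ?\<beta> * p + ?\<alpha> * ?\<beta> * w"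
    using cscalar_prod_lincomb4[OF C(3,2,1) v(1) v(1) E1] v(1) ips
    by (simp add: pq(4))
  have I2: "?s * ?s * w = ?s * z * (cnj r - (1 - ?\<beta>) * p - (1 - ?\<alpha>) * q + (1 - ?\<alpha>) * (1 - ?\<beta>) * w)"
    using cscalar_prod_lincomb4[OF C(4,1,2) v(1) v(1) E5] v(1) ips ba
    by (simp add: algebra_simps)
  \<comment> \<open>\<open>Q\<close> is \<open>s\<close> times the pairing of
    \<open>M\<^sup>-\<^sup>1 v\<close> with \<open>v\<close>. Its only non-real term
    \<open>cnj r\<close> is conjugate to the only non-real term of \<open>I1\<close>. Keeping
    \<open>s w = z Q\<close> as a product avoids division by \<open>z\<close>.\<close>
  define Q where "Q = cnj r - (1 - ?\<beta>) * p - (1 - ?\<alpha>) * q + (1 - ?\<alpha>) * (1 - ?\<beta>) * w"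
  have "Im r = s * w * Im z"
    using arg_cong[OF I1, of Im] by (simp add: ac_simps)
  moreover have "Im Q = - Im r"
    by (simp add: Q_def)
  ultimately have ImQ: "Im Q = - (s * w * Im z)"
    by simp
  have zQ: "?s * w = z * Q"
    using I2 s by (simp add: Q_def)
  have "?s * w * cnj z = complex_of_real ((cmod z)\<^sup>2) * Q"
    unfolding zQ complex_norm_square by (simp add: ac_simps)
  from arg_cong[OF this, of Im] have "s * w * Im z = (cmod z)\<^sup>2 * (s * w * Im z)"
    using ImQ by (simp del: of_real_power)
  then have "Im z = 0 \<or> (cmod z)\<^sup>2 = 1"
    using s w by auto
  then show ?thesis
    by (auto simp: power2_eq_1_iff) (metis norm_ge_zero not_one_le_zero neg_0_le_iff_le)
qed

text \<open>If \<open>v\<close> is an eigenvector of \<open>A B A\<close> with eigenvalue \<open>l\<close>, the span of \<open>v\<close> and \<open>B v\<close> is invariant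
  under the centered product, which has determinant 1 and trace \<open>(l - \<alpha> - \<beta> + 2\<alpha>\<beta>) / spread \<alpha> \<beta>\<close> there; the witness is the eigenvector for the
  larger root of the characteristic equation.\<close>

lemma centered_product_outlier:
  assumes A: "orth_proj n A" and B: "orth_proj n B"
    and \<alpha>: "0 < \<alpha>" "\<alpha> < 1" and \<beta>: "0 < \<beta>" "\<beta> < 1" and le1: "\<alpha> + \<beta> \<le> 1"
    and l: "complex_of_real l \<in># eigs (A * B * A)" "r_plus \<alpha> \<beta> + e \<le> l" and e: "0 < e"
  obtains z where "complex_of_real z \<in># eigs (centered_product n \<alpha> \<beta> A B)"
    "1 + e / (2 * spread \<alpha> \<beta>) \<le> z"
proof -
  note Ac = orth_projD[OF A] and Bc = orth_projD[OF B]
  have M: "centered_product n \<alpha> \<beta> A B \<in> carrier_mat n n" and "A * B * A \<in> carrier_mat n n"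
    using Ac Bc by (auto intro: centered_product_carrier)
  from set_eigs[OF this(2)] l obtain v where
    v: "v \<in> carrier_vec n" "v \<noteq> 0\<^sub>v n" "(A * B * A) *\<^sub>v v = complex_of_real l \<cdot>\<^sub>v v"
    by auto
  define s where "s = spread \<alpha> \<beta>"
  have s: "0 < s" "s\<^sup>2 = \<alpha> * (1 - \<alpha>) * (\<beta> * (1 - \<beta>))"
    using spread_pos[OF \<alpha> \<beta>] spread_square[OF \<alpha> \<beta>] by (auto simp: s_def)
  have l0: "0 < l"
  proof -
    have "0 \<le> r_plus \<alpha> \<beta>"
      by (simp add: r_plus_def)
    then show ?thesis
      using l e by linarith
  qed
  have ABAv: "A *\<^sub>v (B *\<^sub>v (A *\<^sub>v v)) = complex_of_real l \<cdot>\<^sub>v v"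
    using v sandwich_mult_vec[OF Ac(1) Bc(1) v(1)] by simp
  \<comment> \<open>Since \<open>l\<close> is not zero, \<open>v\<close> is a multiple of
    \<open>A B A v\<close> and so lies in the range of \<open>A\<close>.\<close>
  have Av: "A *\<^sub>v v = v"
  proof -
    have "complex_of_real l \<cdot>\<^sub>v (A *\<^sub>v v) = A *\<^sub>v (complex_of_real l \<cdot>\<^sub>v v)"
      using Ac v by (simp add: mult_mat_vec)
    also have "\<dots> = complex_of_real l \<cdot>\<^sub>v v"
      unfolding ABAv[symmetric] using Ac Bc v by (intro orth_proj_idem_vec[OF A]) simp
    finally have eq: "complex_of_real l \<cdot>\<^sub>v (A *\<^sub>v v) = complex_of_real l \<cdot>\<^sub>v v" .
    show ?thesis
    proof (rule eq_vecI)
      fix i assume "i < dim_vec v"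
      then have "complex_of_real l * (A *\<^sub>v v) $ i = complex_of_real l * v $ i"
        using arg_cong[OF eq, of "\<lambda>u. u $ i"] Ac v by (simp del: index_mult_mat_vec)
      then show "(A *\<^sub>v v) $ i = v $ i"
        using l0 by simp
    qed (use Ac v in auto)
  qed
  define b where "b = B *\<^sub>v v"
  have b: "b \<in> carrier_vec n" "B *\<^sub>v b = b" "A *\<^sub>v b = complex_of_real l \<cdot>\<^sub>v v"
    using Bc v orth_proj_idem_vec[OF B v(1)] ABAv Av by (auto simp: b_def)
  define \<mu> where "\<mu> = (l - \<alpha> - \<beta> + 2 * \<alpha> * \<beta>) / s"
  \<comment> \<open>The numbers \<open>\<mu>\<close> and 1 are trace and determinant on the span of
    \<open>v\<close> and \<open>b\<close>. At the edge \<open>l = r_plus \<alpha> \<beta>\<close>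
    the trace is 2, a double root at 1, and it grows with slope \<open>1 / s\<close> in
    \<open>l\<close>.\<close>
  have \<mu>: "2 + e / s \<le> \<mu>"
  proof -
    have "(2 + e / s) * s \<le> l - \<alpha> - \<beta> + 2 * \<alpha> * \<beta>"
      using l s r_plus_eq_spread[OF \<alpha> \<beta>] by (simp add: s_def[symmetric] distrib_right)
    then show ?thesis
      using s by (simp add: \<mu>_def pos_le_divide_eq)
  qed
  have es: "0 < e / s"
    using e s by simp
  define z where "z = (\<mu> + sqrt (\<mu>\<^sup>2 - 4)) / 2"
  have disc: "0 \<le> \<mu>\<^sup>2 - 4"
    using power_mono[of 2 \<mu> 2] \<mu> es by simp
  have z_ge: "1 + e / (2 * s) \<le> z"
  proof -
    have "\<mu> / 2 \<le> z"
      using disc by (simp add: z_def)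
    moreover have "1 + e / (2 * s) = (2 + e / s) / 2"
      by (simp add: add_divide_distrib)
    ultimately show ?thesis
      using \<mu> by linarith
  qed
  have z1: "1 < z"
    using z_ge e s by (smt (verit) divide_pos_pos)
  have quad: "z\<^sup>2 - \<mu> * z + 1 = 0"
  proof -
    have "2 * z - \<mu> = sqrt (\<mu>\<^sup>2 - 4)"
      by (simp add: z_def field_simps)
    then have "(2 * z - \<mu>)\<^sup>2 = \<mu>\<^sup>2 - 4"
      using disc by simp
    then show ?thesis
      by (simp add: power2_eq_square algebra_simps)
  qed
  have zs: "s * z\<^sup>2 = (l - \<alpha> - \<beta> + 2 * \<alpha> * \<beta>) * z - s"
    using quad s by (simp add: \<mu>_def field_simps)
  \<comment> \<open>On the span, \<open>s M\<close> maps \<open>v\<close> to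
    \<open>(l - \<beta> + \<alpha> \<beta>) v - \<alpha> b\<close> and \<open>b\<close> to
    \<open>l (1 - \<beta>) v - \<alpha> (1 - \<beta>) b\<close>. For a vector
    \<open>\<alpha> b - t v\<close> the \<open>b\<close>-coordinate of the eigenvalue equation
    forces this \<open>t\<close>; the \<open>v\<close>-coordinate is then the quadratic equation for
    \<open>z\<close>.\<close>
  define t where "t = s * z + \<alpha> * (1 - \<beta>)"
  have t0: "0 < t"
    using s z1 \<alpha> \<beta> by (simp add: t_def add_pos_pos)
  define w where "w = complex_of_real \<alpha> \<cdot>\<^sub>v b + complex_of_real (- t) \<cdot>\<^sub>v v + 0 \<cdot>\<^sub>v v + 0 \<cdot>\<^sub>v v"
  have w: "w \<in> carrier_vec n"
    using b v by (simp add: w_def)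
  have wi: "w $ i = \<alpha> * b $ i - t * v $ i" if "i < n" for i
    using that b v by (simp add: w_def)
  have Bw: "(B *\<^sub>v w) $ i = (\<alpha> - t) * b $ i" if "i < n" for i
    unfolding mult_mat_vec_lincomb4[OF Bc(1) b(1) v(1) v(1) v(1) w_def]
    using that b v Bc(1) by (simp add: b(2) b_def[symmetric] algebra_simps del: index_mult_mat_vec)
  have Aw: "(A *\<^sub>v w) $ i = (\<alpha> * l - t) * v $ i" if "i < n" for i
    unfolding mult_mat_vec_lincomb4[OF Ac(1) b(1) v(1) v(1) v(1) w_def]
    using that b v Ac(1) by (simp add: Av algebra_simps del: index_mult_mat_vec)
  have ABw: "(A *\<^sub>v (B *\<^sub>v w)) $ i = (\<alpha> - t) * l * v $ i" if "i < n" for i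
  proof -
    have "B *\<^sub>v w = complex_of_real (\<alpha> - t) \<cdot>\<^sub>v b"
      using Bw Bc(1) b by (intro eq_vecI) (auto simp del: index_mult_mat_vec)
    then have "A *\<^sub>v (B *\<^sub>v w) = complex_of_real (\<alpha> - t) \<cdot>\<^sub>v (complex_of_real l \<cdot>\<^sub>v v)"
      using Ac(1) b by (simp add: mult_mat_vec[OF Ac(1)])
    then show ?thesis
      using that v by simp
  qed
  have "centered_product n \<alpha> \<beta> A B *\<^sub>v w = complex_of_real z \<cdot>\<^sub>v w"
  proof (rule eq_vecI)
    fix i assume "i < dim_vec (complex_of_real z \<cdot>\<^sub>v w)"
    then have i: "i < n"
      using w by simp
    have coeff: "(\<alpha> - t) * l - \<beta> * (\<alpha> * l - t) - \<alpha> * \<beta> * t = - s * z * t"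
    proof -
      have "s * z * (s * z) = (l - \<alpha> - \<beta> + 2 * \<alpha> * \<beta>) * (s * z) - s\<^sup>2"
        using arg_cong[OF zs, of "\<lambda>x. s * x"] by (simp add: power2_eq_square algebra_simps)
      moreover have "(\<alpha> - t) * l - \<beta> * (\<alpha> * l - t) - \<alpha> * \<beta> * t + s * z * t
          = s * z * (s * z) - ((l - \<alpha> - \<beta> + 2 * \<alpha> * \<beta>) * (s * z) - \<alpha> * (1 - \<alpha>) * (\<beta> * (1 - \<beta>)))"
        by (simp add: t_def algebra_simps)
      ultimately show ?thesis
        unfolding s(2) by simp
    qed
    have coeff': "- \<alpha> * (\<alpha> - t) + \<alpha> * \<beta> * \<alpha> = s * z * \<alpha>"
      by (simp add: t_def algebra_simps)
    have "(A *\<^sub>v (B *\<^sub>v w)) $ i - \<alpha> * (B *\<^sub>v w) $ i - \<beta> * (A *\<^sub>v w) $ i + \<alpha> * \<beta> * w $ i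
        = complex_of_real ((\<alpha> - t) * l - \<beta> * (\<alpha> * l - t) - \<alpha> * \<beta> * t) * v $ i
          + complex_of_real (- \<alpha> * (\<alpha> - t) + \<alpha> * \<beta> * \<alpha>) * b $ i"
      unfolding ABw[OF i] Bw[OF i] Aw[OF i] wi[OF i] by (simp add: algebra_simps)
    also have "\<dots> = complex_of_real s * (complex_of_real z * w $ i)"
      unfolding coeff coeff' wi[OF i] by (simp add: algebra_simps)
    finally show "(centered_product n \<alpha> \<beta> A B *\<^sub>v w) $ i = (complex_of_real z \<cdot>\<^sub>v w) $ i"
      unfolding centered_product_mult_vec[OF Ac(1) Bc(1) w i] using s w i
      by (simp add: s_def[symmetric])
  qed (use M w in auto)
  moreover have "w \<noteq> 0\<^sub>v n"
  proof
    \<comment> \<open>The danger is \<open>b\<close> being a multiple of \<open>v\<close>, that is,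
      a vector in both ranges. Then \<open>w\<close> vanishes only for the root
      \<open>z = \<alpha> \<beta> / s\<close>, and \<alpha> + \<beta> \<le> 1 makes that root at
      most 1, contrary to \<open>z > 1\<close>.\<close>
    assume w0: "w = 0\<^sub>v n"
    obtain i where i: "i < n" "v $ i \<noteq> 0"
      using v by (metis carrier_vecD eq_vecI index_zero_vec)
    have "A *\<^sub>v w = 0\<^sub>v n" "B *\<^sub>v w = 0\<^sub>v n"
      using w0 Ac(1) Bc(1) by auto
    then have "(\<alpha> * l - t) * v $ i = 0" "(\<alpha> - t) * b $ i = 0" "\<alpha> * b $ i - t * v $ i = 0"
      using Aw[OF i(1)] Bw[OF i(1)] wi[OF i(1)] w0 i by simp_all
    then have "\<alpha> = t"
      using i t0 \<alpha> by auto
    then have sz: "s * z = \<alpha> * \<beta>"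
      by (simp add: t_def algebra_simps)
    have "s\<^sup>2 < (s * z)\<^sup>2"
      using s z1 by (intro power_strict_mono) auto
    then have "\<alpha> * \<beta> * ((1 - \<alpha>) * (1 - \<beta>)) < \<alpha> * \<beta> * (\<alpha> * \<beta>)"
      unfolding sz s(2) by (simp add: power2_eq_square ac_simps)
    then have "(1 - \<alpha>) * (1 - \<beta>) < \<alpha> * \<beta>"
      using \<alpha> \<beta> by (simp add: mult_less_cancel_left_pos)
    then show False
      using le1 by (simp add: algebra_simps)
  qed
  ultimately have "complex_of_real z \<in># eigs (centered_product n \<alpha> \<beta> A B)"
    using set_eigs[OF M] w by auto
  then show ?thesis
    using that z_ge by (simp add: s_def)
qed

text \<open>An even power of a real eigenvalue is nonnegative and a power of an eigenvalue of
  modulus one has real part at least -1, so nothing can cancel an outlier by more than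
  \<open>n\<close>. The first bound makes trace plus \<open>n\<close> a nonnegative variable, as
  Markov's inequality requires.\<close>

lemma Re_trace_centered_product_pow:
  assumes A: "orth_proj n A" and B: "orth_proj n B"
    and \<alpha>: "0 < \<alpha>" "\<alpha> < 1" and \<beta>: "0 < \<beta>" "\<beta> < 1" and a: "even a"
  shows "- real n \<le> Re (mat_trace (centered_product n \<alpha> \<beta> A B ^\<^sub>m a))"
    and "\<lbrakk>\<alpha> + \<beta> \<le> 1; 0 < n; 0 < e; r_plus \<alpha> \<beta> + e \<le> lambda_max (A * B * A)\<rbrakk> \<Longrightarrow>
      (1 + e / (2 * spread \<alpha> \<beta>)) ^ a - real n \<le> Re (mat_trace (centered_product n \<alpha> \<beta> A B ^\<^sub>m a))"
proof -
  let ?M = "centered_product n \<alpha> \<beta> A B"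
  have M: "?M \<in> carrier_mat n n"
    using orth_projD[OF A] orth_projD[OF B] by (intro centered_product_carrier)
  have tr: "Re (mat_trace (?M ^\<^sub>m a)) = (\<Sum>z\<in>#eigs ?M. Re (z ^ a))"
    unfolding mat_trace_pow[OF M] by (rule Re_sum_mset)
  have ge: "- 1 \<le> Re (z ^ a)" if "z \<in># eigs ?M" for z
    using centered_product_eigenvalue_real_or_unit[OF A B \<alpha> \<beta> that]
  proof
    assume "Im z = 0"
    then have "z ^ a = complex_of_real (Re z ^ a)"
      by (metis complex_is_Real_iff of_real_Re of_real_power)
    then show ?thesis
      using zero_le_even_power[OF a, of "Re z"] by simp
  next
    assume "cmod z = 1"
    then have "cmod (z ^ a) = 1"
      by (simp add: norm_power)
    then show ?thesis
      using abs_Re_le_cmod[of "z ^ a"] by linarith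
  qed
  \<comment> \<open>Stated for submultisets so that one copy of the outlier can be split off and the
    remaining eigenvalues bounded below.\<close>
  have sub: "- real (size K) \<le> (\<Sum>z\<in>#K. Re (z ^ a))" if "K \<subseteq># eigs ?M" for K
  proof -
    have "(\<Sum>z\<in>#K. - 1) \<le> (\<Sum>z\<in>#K. Re (z ^ a))"
      using that by (intro sum_mset_mono ge) (metis mset_subset_eqD)
    then show ?thesis
      by simp
  qed
  show "- real n \<le> Re (mat_trace (?M ^\<^sub>m a))"
    using sub[of "eigs ?M"] tr size_eigs[OF M] by simp
  assume le1: "\<alpha> + \<beta> \<le> 1" and n: "0 < n" and e: "0 < e"
    and l: "r_plus \<alpha> \<beta> + e \<le> lambda_max (A * B * A)"
  obtain x where x: "complex_of_real x \<in># eigs ?M" "1 + e / (2 * spread \<alpha> \<beta>) \<le> x"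
    using centered_product_outlier[OF A B \<alpha> \<beta> le1 lambda_max_sandwich(1)[OF A B n] l e] by blast
  obtain K where K: "eigs ?M = add_mset (complex_of_real x) K"
    using x by (metis mset_add)
  have "(1 + e / (2 * spread \<alpha> \<beta>)) ^ a \<le> x ^ a"
    using x e spread_pos[OF \<alpha> \<beta>] by (intro power_mono) auto
  moreover have "Re (complex_of_real x ^ a) = x ^ a"
    by (simp flip: of_real_power)
  moreover have "- real n \<le> (\<Sum>z\<in>#K. Re (z ^ a))"
    using sub[of K] size_eigs[OF M] unfolding K by simp
  ultimately show "(1 + e / (2 * spread \<alpha> \<beta>)) ^ a - real n \<le> Re (mat_trace (?M ^\<^sub>m a))"
    unfolding tr K by simp
qed

subsection \<open>Bounded random matrices\<close>

text \<open>Boundedness accompanies measurability so that traces of polynomials in such matrices are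
  integrable; otherwise the expectation in the moment bound could be the default value 0 of the
  integral and carry no information.\<close>

definition bounded_random_mat :: "'w measure \<Rightarrow> nat \<Rightarrow> ('w \<Rightarrow> complex mat) \<Rightarrow> bool" where
  "bounded_random_mat Q n M \<longleftrightarrow>
     (\<forall>w\<in>space Q. M w \<in> carrier_mat n n) \<and>
     (\<forall>r<n. \<forall>s<n. (\<lambda>w. M w $$ (r, s)) \<in> borel_measurable Q) \<and>
     (\<exists>K. \<forall>w\<in>space Q. \<forall>r<n. \<forall>s<n. cmod (M w $$ (r, s)) \<le> K)"

lemma bounded_random_matI:
  assumes "\<And>w. w \<in> space Q \<Longrightarrow> M w \<in> carrier_mat n n"
    and "\<And>r s. r < n \<Longrightarrow> s < n \<Longrightarrow> (\<lambda>w. M w $$ (r, s)) \<in> borel_measurable Q"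
    and "\<And>w r s. w \<in> space Q \<Longrightarrow> r < n \<Longrightarrow> s < n \<Longrightarrow> cmod (M w $$ (r, s)) \<le> K"
  shows "bounded_random_mat Q n M"
  using assms unfolding bounded_random_mat_def by blast

lemma bounded_random_matE:
  assumes "bounded_random_mat Q n M"
  obtains K where "\<And>w. w \<in> space Q \<Longrightarrow> M w \<in> carrier_mat n n"
    "\<And>r s. r < n \<Longrightarrow> s < n \<Longrightarrow> (\<lambda>w. M w $$ (r, s)) \<in> borel_measurable Q"
    "\<And>w r s. w \<in> space Q \<Longrightarrow> r < n \<Longrightarrow> s < n \<Longrightarrow> cmod (M w $$ (r, s)) \<le> K"
  using assms unfolding bounded_random_mat_def by blast

lemma bounded_random_mat_mult:
  assumes X: "bounded_random_mat Q n X" and Y: "bounded_random_mat Q n Y"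
  shows "bounded_random_mat Q n (\<lambda>w. X w * Y w)"
proof -
  obtain K where K: "\<And>w. w \<in> space Q \<Longrightarrow> X w \<in> carrier_mat n n"
    "\<And>r s. r < n \<Longrightarrow> s < n \<Longrightarrow> (\<lambda>w. X w $$ (r, s)) \<in> borel_measurable Q"
    "\<And>w r s. w \<in> space Q \<Longrightarrow> r < n \<Longrightarrow> s < n \<Longrightarrow> cmod (X w $$ (r, s)) \<le> K"
    using X by (rule bounded_random_matE) blast
  obtain L where L: "\<And>w. w \<in> space Q \<Longrightarrow> Y w \<in> carrier_mat n n"
    "\<And>r s. r < n \<Longrightarrow> s < n \<Longrightarrow> (\<lambda>w. Y w $$ (r, s)) \<in> borel_measurable Q"
    "\<And>w r s. w \<in> space Q \<Longrightarrow> r < n \<Longrightarrow> s < n \<Longrightarrow> cmod (Y w $$ (r, s)) \<le> L"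
    using Y by (rule bounded_random_matE) blast
  have entry: "(X w * Y w) $$ (r, s) = (\<Sum>l<n. X w $$ (r, l) * Y w $$ (l, s))"
    if "w \<in> space Q" "r < n" "s < n" for w r s
    using mult_mat_index_sum[OF K(1) L(1)] that by blast
  show ?thesis
  proof (rule bounded_random_matI)
    fix r s assume rs: "r < n" "s < n"
    have "(\<lambda>w. \<Sum>l<n. X w $$ (r, l) * Y w $$ (l, s)) \<in> borel_measurable Q"
      using K(2) L(2) rs by (intro borel_measurable_sum borel_measurable_times) auto
    then show "(\<lambda>w. (X w * Y w) $$ (r, s)) \<in> borel_measurable Q"
      using measurable_cong[of Q "\<lambda>w. (X w * Y w) $$ (r, s)"
          "\<lambda>w. \<Sum>l<n. X w $$ (r, l) * Y w $$ (l, s)" borel] entry rs by simp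
    fix w assume w: "w \<in> space Q"
    have "cmod ((X w * Y w) $$ (r, s)) \<le> (\<Sum>l<n. cmod (X w $$ (r, l)) * cmod (Y w $$ (l, s)))"
      unfolding entry[OF w rs] by (rule order_trans[OF norm_sum]) (simp add: norm_mult)
    also have "\<dots> \<le> (\<Sum>l<n. K * L)"
      using K(3)[OF w] L(3)[OF w] rs
      by (intro sum_mono mult_mono) (auto intro: order_trans[OF norm_ge_zero])
    finally show "cmod ((X w * Y w) $$ (r, s)) \<le> (\<Sum>l<n. K * L)" .
  qed (use K(1) L(1) in \<open>meson mult_carrier_mat\<close>)
qed

lemma bounded_random_mat_pow:
  assumes X: "bounded_random_mat Q n X"
  shows "bounded_random_mat Q n (\<lambda>w. X w ^\<^sub>m a)"
proof (induction a)
  case 0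
  have X1: "\<And>w. w \<in> space Q \<Longrightarrow> X w ^\<^sub>m 0 = 1\<^sub>m n"
    using X unfolding bounded_random_mat_def by auto
  show ?case
  proof (rule bounded_random_matI)
    fix r s assume rs: "r < n" "s < n"
    show "(\<lambda>w. (X w ^\<^sub>m 0) $$ (r, s)) \<in> borel_measurable Q"
      using measurable_cong[of Q "\<lambda>w. (X w ^\<^sub>m 0) $$ (r, s)" "\<lambda>w. 1\<^sub>m n $$ (r, s)" borel] X1
      by (simp del: pow_mat.simps)
    show "cmod ((X w ^\<^sub>m 0) $$ (r, s)) \<le> 1" if "w \<in> space Q" for w
      unfolding X1[OF that] using rs by simp
  qed (use X1 in \<open>simp del: pow_mat.simps\<close>)
next
  case (Suc a)
  then show ?case
    using bounded_random_mat_mult[OF Suc.IH X] by simp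
qed

lemma bounded_random_mat_shifted:
  assumes X: "bounded_random_mat Q n X"
  shows "bounded_random_mat Q n (\<lambda>w. c \<cdot>\<^sub>m (X w - a \<cdot>\<^sub>m 1\<^sub>m n))"
proof -
  obtain K where K: "\<And>w. w \<in> space Q \<Longrightarrow> X w \<in> carrier_mat n n"
    "\<And>r s. r < n \<Longrightarrow> s < n \<Longrightarrow> (\<lambda>w. X w $$ (r, s)) \<in> borel_measurable Q"
    "\<And>w r s. w \<in> space Q \<Longrightarrow> r < n \<Longrightarrow> s < n \<Longrightarrow> cmod (X w $$ (r, s)) \<le> K"
    using X by (rule bounded_random_matE) blast
  have entry: "(c \<cdot>\<^sub>m (X w - a \<cdot>\<^sub>m 1\<^sub>m n)) $$ (r, s) = c * (X w $$ (r, s) - (if r = s then a else 0))"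
    if "w \<in> space Q" "r < n" "s < n" for w r s
    using K(1)[OF that(1)] that by simp
  show ?thesis
  proof (rule bounded_random_matI)
    fix r s assume rs: "r < n" "s < n"
    have "(\<lambda>w. c * (X w $$ (r, s) - (if r = s then a else 0))) \<in> borel_measurable Q"
      using K(2)[OF rs] by simp
    then show "(\<lambda>w. (c \<cdot>\<^sub>m (X w - a \<cdot>\<^sub>m 1\<^sub>m n)) $$ (r, s)) \<in> borel_measurable Q"
      using measurable_cong[of Q "\<lambda>w. (c \<cdot>\<^sub>m (X w - a \<cdot>\<^sub>m 1\<^sub>m n)) $$ (r, s)"
          "\<lambda>w. c * (X w $$ (r, s) - (if r = s then a else 0))" borel] entry[OF _ rs] by blast
    fix w assume w: "w \<in> space Q"
    have "cmod (X w $$ (r, s) - (if r = s then a else 0)) \<le> K + cmod a"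
      using norm_triangle_ineq4[of "X w $$ (r, s)" "if r = s then a else 0"] K(3)[OF w rs]
        norm_ge_zero[of a] by (auto split: if_splits simp del: norm_ge_zero)
    then show "cmod ((c \<cdot>\<^sub>m (X w - a \<cdot>\<^sub>m 1\<^sub>m n)) $$ (r, s)) \<le> cmod c * (K + cmod a)"
      unfolding entry[OF w rs] norm_mult by (rule mult_left_mono) simp
  qed (use K(1) in \<open>auto intro!: smult_carrier_mat minus_carrier_mat\<close>)
qed

lemma integrable_mat_trace:
  assumes Q: "prob_space Q" and M: "bounded_random_mat Q n M"
  shows "integrable Q (\<lambda>w. mat_trace (M w))"
proof -
  interpret prob_space Q by fact
  obtain K where K: "\<And>w. w \<in> space Q \<Longrightarrow> M w \<in> carrier_mat n n"
    "\<And>r s. r < n \<Longrightarrow> s < n \<Longrightarrow> (\<lambda>w. M w $$ (r, s)) \<in> borel_measurable Q"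
    "\<And>w r s. w \<in> space Q \<Longrightarrow> r < n \<Longrightarrow> s < n \<Longrightarrow> cmod (M w $$ (r, s)) \<le> K"
    using M by (rule bounded_random_matE) blast
  have "integrable Q (\<lambda>w. \<Sum>i<n. M w $$ (i, i))"
    using K by (intro Bochner_Integration.integrable_sum integrable_const_bound[where B = K]) auto
  also have "?this \<longleftrightarrow> integrable Q (\<lambda>w. mat_trace (M w))"
    using K(1) by (intro Bochner_Integration.integrable_cong) (auto simp: mat_trace_def)
  finally show ?thesis .
qed

text \<open>The diagonal entry of \<open>A * A = A\<close> is the squared norm \<open>c\<close> of
  the row. As \<open>c\<close> is itself an entry of that row, \<open>c\<close> squared is at most
  \<open>c\<close>.\<close>

lemma orth_proj_entry_le_1:
  assumes A: "orth_proj n A" and rs: "r < n" "s < n"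
  shows "cmod (A $$ (r, s)) \<le> 1"
proof -
  note Ac = orth_projD[OF A]
  define c where "c = (\<Sum>l<n. (cmod (A $$ (r, l)))\<^sup>2)"
  have le_c: "(cmod (A $$ (r, l)))\<^sup>2 \<le> c" if "l < n" for l
    unfolding c_def using that by (intro member_le_sum) auto
  have "A $$ (r, r) = (A * A) $$ (r, r)"
    using Ac by simp
  also have "\<dots> = (\<Sum>l<n. A $$ (r, l) * A $$ (l, r))"
    using mult_mat_index_sum[OF Ac(1) Ac(1) rs(1) rs(1)] .
  also have "\<dots> = (\<Sum>l<n. complex_of_real ((cmod (A $$ (r, l)))\<^sup>2))"
  proof (intro sum.cong refl)
    fix l assume "l \<in> {..<n}"
    then have "A $$ (l, r) = cnj (A $$ (r, l))"
      using Ac(2) rs unfolding hermitian_mat_def by blast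
    then show "A $$ (r, l) * A $$ (l, r) = complex_of_real ((cmod (A $$ (r, l)))\<^sup>2)"
      by (simp only: complex_norm_square)
  qed
  also have "\<dots> = complex_of_real c"
    by (simp add: c_def)
  finally have "c\<^sup>2 \<le> c"
    using le_c[OF rs(1)] by simp
  moreover have "0 \<le> c"
    by (simp add: c_def sum_nonneg)
  ultimately have "c \<le> 1"
    by (cases "c = 0") (auto simp: power2_eq_square)
  then show ?thesis
    using le_c[OF rs(2)] by (metis abs_norm_cancel abs_square_le_1 order_trans)
qed

lemma bounded_random_orth_proj:
  assumes "\<And>r s. r < n \<Longrightarrow> s < n \<Longrightarrow> (\<lambda>w. A w $$ (r, s)) \<in> borel_measurable Q"
    and "\<And>w. w \<in> space Q \<Longrightarrow> orth_proj n (A w)"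
  shows "bounded_random_mat Q n A"
  using assms orth_projD(1) orth_proj_entry_le_1 by (intro bounded_random_matI[where K = 1]) blast+

subsection \<open>Test functions detecting the edge\<close>

text \<open>On the unit interval \<open>edge_test m c\<close> is the polynomial \<open>x ^ m * (1 - c * x)\<close>, so that its integral
  against the empirical spectral distribution is a combination of traces and hence measurable. The
  factor \<open>1 - x\<close> (\<open>c = 1\<close>) removes the singularity of the density at \<open>1\<close>.\<close>

definition edge_test :: "nat \<Rightarrow> real \<Rightarrow> real \<Rightarrow> real" where
  "edge_test m c x = (let h = max 0 (min x (2 - x)) in h ^ m * (1 - c * h))"

lemma edge_test_unit: "0 \<le> x \<Longrightarrow> x \<le> 1 \<Longrightarrow> edge_test m c x = x ^ m * (1 - c * x)"
  by (simp add: edge_test_def)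

lemma continuous_edge_test: "continuous_on UNIV (edge_test m c)"
  unfolding edge_test_def Let_def by (intro continuous_intros)

lemma compact_supp_edge_test: "1 \<le> m \<Longrightarrow> compact_supp (edge_test m c)"
  unfolding compact_supp_def edge_test_def by (rule exI[of _ 2]) (auto simp: Let_def)

lemma esd_integral_edge_test:
  assumes A: "orth_proj n A" and B: "orth_proj n B"
  shows "esd_integral (A * B * A) (edge_test m c) =
    (Re (mat_trace ((A * B * A) ^\<^sub>m m)) - c * Re (mat_trace ((A * B * A) ^\<^sub>m Suc m))) / real n"
proof -
  have C: "A * B * A \<in> carrier_mat n n"
    using orth_projD[OF A] orth_projD[OF B] by auto
  have "(\<Sum>z\<in>#eigs (A * B * A). edge_test m c (Re z))
      = (\<Sum>z\<in>#eigs (A * B * A). Re (z ^ m) - c * Re (z ^ Suc m))"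
  proof (intro arg_cong[where f = sum_mset] image_mset_cong)
    fix z assume "z \<in># eigs (A * B * A)"
    note E = eigs_sandwich[OF A B this]
    have "Re (z ^ j) = Re z ^ j" for j
      by (subst E(1)) (simp flip: of_real_power)
    then show "edge_test m c (Re z) = Re (z ^ m) - c * Re (z ^ Suc m)"
      using E(2,3) by (simp only: edge_test_unit) (simp add: algebra_simps)
  qed
  also have "\<dots> = Re (\<Sum>z\<in>#eigs (A * B * A). z ^ m) - c * Re (\<Sum>z\<in>#eigs (A * B * A). z ^ Suc m)"
  proof -
    have "(\<Sum>z\<in>#K. Re (z ^ m) - c * Re (z ^ Suc m))
        = Re (\<Sum>z\<in>#K. z ^ m) - c * Re (\<Sum>z\<in>#K. z ^ Suc m)" for K
      by (induction K) (auto simp: algebra_simps)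
    then show ?thesis .
  qed
  finally show ?thesis
    by (simp only: esd_integral_def mat_trace_pow[OF C] carrier_matD(1)[OF C])
qed

section \<open>Mass of the limit law near its edge\<close>

lemma r_bounds:
  assumes \<alpha>: "0 < \<alpha>" "\<alpha> < 1" and \<beta>: "0 < \<beta>" "\<beta> < 1"
  shows "0 \<le> r_minus \<alpha> \<beta>" "r_minus \<alpha> \<beta> < r_plus \<alpha> \<beta>" "r_plus \<alpha> \<beta> \<le> 1"
proof -
  show "0 \<le> r_minus \<alpha> \<beta>"
    by (simp add: r_minus_def)
  have "0 < sqrt (\<alpha> * (1 - \<beta>)) * sqrt (\<beta> * (1 - \<alpha>))"
    using \<alpha> \<beta> by simp
  then show "r_minus \<alpha> \<beta> < r_plus \<alpha> \<beta>"
    by (simp add: r_minus_def r_plus_def power2_eq_square algebra_simps)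
  have "spread \<alpha> \<beta> = sqrt (\<alpha> * \<beta> * ((1 - \<alpha>) * (1 - \<beta>)))"
    by (simp add: spread_def ac_simps flip: real_sqrt_mult)
  also have "\<dots> \<le> (\<alpha> * \<beta> + (1 - \<alpha>) * (1 - \<beta>)) / 2"
    using \<alpha> \<beta> by (intro arith_geo_mean_sqrt) auto
  finally show "r_plus \<alpha> \<beta> \<le> 1"
    unfolding r_plus_eq_spread[OF \<alpha> \<beta>] by (simp add: algebra_simps)
qed

text \<open>Used when \<alpha> + \<beta> > 1, where the atom at 1 already gives the lower bound.
  Integrability is not at issue: the integral of a nonnegative function is nonnegative, its default
  value 0 included.\<close>

lemma manova_integral_nonneg_part:
  assumes \<alpha>: "0 < \<alpha>" "\<alpha> < 1" and \<beta>: "0 < \<beta>" "\<beta> < 1"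
    and f: "\<And>x. 0 \<le> x \<Longrightarrow> x \<le> 1 \<Longrightarrow> 0 \<le> f x"
  shows "0 \<le> (LINT x:{r_minus \<alpha> \<beta>..r_plus \<alpha> \<beta>}|lborel. f x * manova_density \<alpha> \<beta> x)"
  unfolding set_lebesgue_integral_def
proof (rule integral_nonneg_AE, rule AE_I2)
  fix x
  show "0 \<le> indicat_real {r_minus \<alpha> \<beta>..r_plus \<alpha> \<beta>} x *\<^sub>R (f x * manova_density \<alpha> \<beta> x)"
    using r_bounds[OF \<alpha> \<beta>] f[of x] by (auto simp: manova_density_def indicator_def)
qed

text \<open>The integral is restricted to an interval from \<open>p\<close> to \<open>q\<close>, the
  midpoint of \<open>p\<close> and the right end of the support. There \<open>x ^ m\<close> is at
  least \<open>p ^ m\<close> and the square root is bounded below; the interval does not depend on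
  \<open>m\<close>, hence neither does \<open>C\<close>.\<close>

lemma manova_integral_edge_test_ge:
  assumes \<alpha>: "0 < \<alpha>" "\<alpha> < 1" and \<beta>: "0 < \<beta>" "\<beta> < 1"
    and p: "r_minus \<alpha> \<beta> < p" "p < r_plus \<alpha> \<beta>"
  obtains C where "0 < C" "\<And>m. C * p ^ m \<le> manova_integral \<alpha> \<beta> (edge_test (Suc m) 1)"
proof -
  define a b where "a = r_minus \<alpha> \<beta>" and "b = r_plus \<alpha> \<beta>"
  note r = r_bounds[OF \<alpha> \<beta>, folded a_def b_def] and p = p[folded a_def b_def]
  define q where "q = (p + b) / 2"
  have q: "p < q" "q < b"
    using p by (auto simp: q_def)
  define d where "d = sqrt ((b - q) * (p - a)) / (2 * pi)"
  have d: "0 < d"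
    using p q by (simp add: d_def)
  have "(q - p) * d * p ^ m \<le> manova_integral \<alpha> \<beta> (edge_test (Suc m) 1)" for m
  proof -
    define G where "G x = x ^ m * sqrt ((b - x) * (x - a)) / (2 * pi)" for x :: real
    have G0: "0 \<le> G x" if "x \<in> {a..b}" for x
      using that r by (simp add: G_def)
    have G_eq: "edge_test (Suc m) 1 x * manova_density \<alpha> \<beta> x = G x" if x: "x \<in> {a..b}" for x
    proof -
      have "edge_test (Suc m) 1 x = x ^ Suc m * (1 - x)"
        using x r by (subst edge_test_unit) auto
      \<comment> \<open>At 0 and 1 the density is 0 by division by zero. Such a point in the support
        must be its endpoint, so the square root in \<open>G\<close> vanishes as well.\<close>
      moreover have "x = 0 \<Longrightarrow> a = 0" "x = 1 \<Longrightarrow> b = 1"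
        using x r by auto
      ultimately show ?thesis
        by (cases "x = 0"; cases "x = 1")
           (auto simp: manova_density_def G_def simp flip: a_def b_def)
    qed
    have G_int: "integrable lborel (\<lambda>x. indicat_real {a..b} x *\<^sub>R G x)"
    proof -
      have "continuous_on {a..b} G"
        unfolding G_def by (intro continuous_intros) auto
      from borel_integrable_atLeastAtMost'[OF this] show ?thesis
        unfolding set_integrable_def .
    qed
    have "(q - p) * d * p ^ m = (LINT x|lborel. indicat_real {p..q} x * (p ^ m * d))"
      using q by simp
    also have "\<dots> \<le> (LINT x|lborel. indicat_real {a..b} x *\<^sub>R G x)"
    proof (rule integral_mono[OF _ G_int])
      show "integrable lborel (\<lambda>x. indicat_real {p..q} x * (p ^ m * d))"
        using q by (intro integrable_mult_left integrable_real_indicator) (auto simp: emeasure_lborel_Icc)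
      fix x :: real
      show "indicat_real {p..q} x * (p ^ m * d) \<le> indicat_real {a..b} x *\<^sub>R G x"
      proof (cases "x \<in> {p..q}")
        case True
        then have "x \<in> {a..b}"
          using p q by auto
        have "p ^ m * d \<le> x ^ m * (sqrt ((b - x) * (x - a)) / (2 * pi))"
        proof (rule mult_mono)
          show "p ^ m \<le> x ^ m"
            using True r p by (intro power_mono) auto
          show "d \<le> sqrt ((b - x) * (x - a)) / (2 * pi)"
            unfolding d_def using True p q
            by (intro divide_right_mono real_sqrt_le_mono mult_mono) auto
        qed (use True r p d in auto)
        then show ?thesis
          using True \<open>x \<in> {a..b}\<close> by (simp add: G_def)
      next
        case False
        then show ?thesis
          using G0[of x] by (cases "x \<in> {a..b}") auto
      qed
    qed
    also have "\<dots> = (LINT x:{a..b}|lborel. edge_test (Suc m) 1 x * manova_density \<alpha> \<beta> x)"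
      unfolding set_lebesgue_integral_def[symmetric]
      by (rule set_lebesgue_integral_cong) (auto simp: G_eq)
    \<comment> \<open>The test function vanishes at 0 and at 1, so neither atom contributes.\<close>
    also have "\<dots> = manova_integral \<alpha> \<beta> (edge_test (Suc m) 1)"
      by (simp add: manova_integral_def edge_test_def a_def b_def)
    finally show ?thesis .
  qed
  then show ?thesis
    using that[of "(q - p) * d"] q d by simp
qed

text \<open>If every eigenvalue were below the edge by \<open>e\<close>, the spectral integral of
  the test function would decay at the rate \<open>t ^ m\<close> with
  \<open>t = max 0 (edge \<alpha> \<beta> - e)\<close>. The limit law decays more slowly: not below
  the mass \<open>\<alpha> + \<beta> - 1\<close> of the atom at 1, or at least like
  \<open>p ^ m\<close> with \<open>p > t\<close>. A large \<open>m\<close> separates the two, and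
  the factor 1/2 leaves a gap for convergence in probability.\<close>

lemma edge_detection:
  assumes \<alpha>: "0 < \<alpha>" "\<alpha> < 1" and \<beta>: "0 < \<beta>" "\<beta> < 1" and e: "0 < e"
  obtains m c where "1 \<le> m" "0 \<le> c"
    "(max 0 (edge \<alpha> \<beta> - e)) ^ m < manova_integral \<alpha> \<beta> (edge_test m c) / 2"
proof (cases "\<alpha> + \<beta> > 1")
  case True
  define t where "t = max 0 (1 - e)"
  have t: "0 \<le> t" "t < 1"
    using e by (auto simp: t_def)
  obtain m where m: "t ^ m < (\<alpha> + \<beta> - 1) / 2"
    using real_arch_pow_inv[of "(\<alpha> + \<beta> - 1) / 2" t] True t by auto
  have "\<alpha> + \<beta> - 1 \<le> manova_integral \<alpha> \<beta> (edge_test (Suc m) 0)"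
    using manova_integral_nonneg_part[OF \<alpha> \<beta>, of "edge_test (Suc m) 0"] True
    by (simp add: manova_integral_def edge_test_def Let_def)
  moreover have "t ^ Suc m \<le> t ^ m"
    using t by (intro power_decreasing) auto
  ultimately show ?thesis
    using that[of "Suc m" 0] m True by (simp add: edge_def t_def)
next
  case False
  note r = r_bounds[OF \<alpha> \<beta>]
  define t where "t = max 0 (r_plus \<alpha> \<beta> - e)"
  define p where "p = (max (r_minus \<alpha> \<beta>) t + r_plus \<alpha> \<beta>) / 2"
  have t: "0 \<le> t" "t < r_plus \<alpha> \<beta>"
    using e r by (auto simp: t_def)
  have p: "r_minus \<alpha> \<beta> < p" "p < r_plus \<alpha> \<beta>" "t < p"
    using t r by (auto simp: p_def)
  obtain C where C: "0 < C" "\<And>m. C * p ^ m \<le> manova_integral \<alpha> \<beta> (edge_test (Suc m) 1)"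
    using manova_integral_edge_test_ge[OF \<alpha> \<beta> p(1,2)] by blast
  obtain m where m: "(t / p) ^ m < C / 2"
    using real_arch_pow_inv[of "C / 2" "t / p"] C p t by auto
  have "t ^ Suc m \<le> t ^ m"
    using t r by (intro power_decreasing) auto
  also have "t ^ m < C / 2 * p ^ m"
    using m p t by (simp add: power_divide divide_less_eq)
  also have "\<dots> \<le> manova_integral \<alpha> \<beta> (edge_test (Suc m) 1) / 2"
    using C(2)[of m] by simp
  finally show ?thesis
    using that[of "Suc m" 1] False by (simp add: edge_def t_def)
qed

lemma esd_integral_edge_test_le:
  assumes A: "orth_proj n A" and B: "orth_proj n B" and n: "0 < n" and c: "0 \<le> c"
    and l: "lambda_max (A * B * A) \<le> t"
  shows "esd_integral (A * B * A) (edge_test m c) \<le> t ^ m"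
proof -
  have C: "A * B * A \<in> carrier_mat n n"
    using orth_projD[OF A] orth_projD[OF B] by auto
  have "(\<Sum>z\<in>#eigs (A * B * A). edge_test m c (Re z)) \<le> (\<Sum>z\<in>#eigs (A * B * A). t ^ m)"
  proof (rule sum_mset_mono)
    fix z assume z: "z \<in># eigs (A * B * A)"
    note E = eigs_sandwich[OF A B z]
    have "edge_test m c (Re z) \<le> Re z ^ m"
      using E c by (simp add: edge_test_unit mult_left_le)
    also have "\<dots> \<le> t ^ m"
      using E lambda_max_sandwich(2)[OF A B n z] l by (intro power_mono) auto
    finally show "edge_test m c (Re z) \<le> t ^ m" .
  qed
  then show ?thesis
    using n size_eigs[OF C] carrier_matD(1)[OF C]
    by (simp add: esd_integral_def divide_le_eq mult.commute del: index_mult_mat)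
qed

subsection \<open>Convergence of the edge\<close>

text \<open>The set \<open>S\<close> need not be measurable; a non-measurable set has measure \<open>0\<close>.\<close>

lemma measure_le_of_subset_Un:
  assumes "prob_space Q" "S \<subseteq> U \<union> V" "U \<in> sets Q" "V \<in> sets Q"
  shows "measure Q S \<le> measure Q U + measure Q V"
proof -
  interpret prob_space Q by fact
  have "measure Q S \<le> measure Q (U \<union> V)"
    using assms by (cases "S \<in> sets Q") (auto intro: finite_measure_mono simp: measure_notin_sets)
  also have "\<dots> \<le> measure Q U + measure Q V"
    using assms by (intro measure_Un_le) auto
  finally show ?thesis .
qed

section \<open>Growth rates and the probability of an outlier\<close>

lemma strict_mono_eventually_pos:
  fixes N :: "nat \<Rightarrow> nat"
  assumes "strict_mono N"
  shows "eventually (\<lambda>i. 0 < N i) sequentially"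
proof (rule eventually_sequentiallyI[of 1])
  fix i :: nat assume "1 \<le> i"
  then show "0 < N i"
    using strict_mono_imp_increasing[OF assms, of i] by linarith
qed

text \<open>With \<open>L = ln q\<close>, half of the rate \<open>L\<close> absorbs the numerator:
  eventually \<open>\<epsilon> i < L / 2\<close> and \<open>ln (N i) \<le> L / 2 * k i\<close>. The
  other half drives the quotient to 0.\<close>

lemma growth_bound_tendsto_0:
  fixes N k :: "nat \<Rightarrow> nat" and \<epsilon> :: "nat \<Rightarrow> real"
  assumes N: "strict_mono N" and k: "(\<lambda>i. ln (real (N i))) \<in> o(\<lambda>i. real (k i))"
    and \<epsilon>: "\<epsilon> \<longlonglongrightarrow> 0" and q: "1 < q"
  shows "filterlim k at_top sequentially"
    and "(\<lambda>i. (exp (\<epsilon> i * real (k i)) + real (N i)) / q ^ (2 * (k i div 2))) \<longlonglongrightarrow> 0"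
proof -
  have N_top: "filterlim (\<lambda>i. real (N i)) at_top sequentially"
    using filterlim_compose[OF filterlim_real_sequentially filterlim_subseq[OF N]] .
  have lnN_top: "filterlim (\<lambda>i. ln (real (N i))) at_top sequentially"
    by (rule filterlim_compose[OF ln_at_top N_top])
  have "eventually (\<lambda>i. ln (real (N i)) \<le> real (k i)) sequentially"
    using landau_o.smallD[OF k, of 1] by (auto elim!: eventually_mono)
  then have k_top: "filterlim (\<lambda>i. real (k i)) at_top sequentially"
    by (rule filterlim_at_top_mono[OF lnN_top])
  then show "filterlim k at_top sequentially"
    by (simp add: filterlim_sequentially_iff_filterlim_real)
  define L where "L = ln q"
  have L: "0 < L" "exp L = q"
    using q by (auto simp: L_def)
  have "filterlim (\<lambda>i. - (L / 2) * real (k i)) at_bot sequentially"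
    using filterlim_tendsto_neg_mult_at_bot[OF tendsto_const _ k_top, of "- (L / 2)"] L by simp
  then have "((\<lambda>i. exp (- (L / 2) * real (k i))) \<longlongrightarrow> 0) sequentially"
    by (rule filterlim_compose[OF exp_at_bot])
  then have lim: "(\<lambda>i. 2 * q * exp (- (L / 2) * real (k i))) \<longlonglongrightarrow> 0"
    by (rule tendsto_mult_right_zero)
  show "(\<lambda>i. (exp (\<epsilon> i * real (k i)) + real (N i)) / q ^ (2 * (k i div 2))) \<longlonglongrightarrow> 0"
  proof (rule tendsto_sandwich[OF _ _ tendsto_const lim])
    show "eventually (\<lambda>i. 0 \<le> (exp (\<epsilon> i * real (k i)) + real (N i)) / q ^ (2 * (k i div 2))) sequentially"
      using q by (intro always_eventually allI divide_nonneg_pos add_nonneg_nonneg) auto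
    have "eventually (\<lambda>i. \<epsilon> i < L / 2) sequentially"
      using \<epsilon> L by (intro order_tendstoD(2)[OF \<epsilon>]) auto
    moreover have "eventually (\<lambda>i. norm (ln (real (N i))) \<le> L / 2 * norm (real (k i))) sequentially"
      using L by (intro landau_o.smallD[OF k]) auto
    moreover have "eventually (\<lambda>i. 0 < N i) sequentially"
      using N by (rule strict_mono_eventually_pos)
    ultimately show "eventually (\<lambda>i. (exp (\<epsilon> i * real (k i)) + real (N i)) / q ^ (2 * (k i div 2))
        \<le> 2 * q * exp (- (L / 2) * real (k i))) sequentially"
    proof eventually_elim
      case (elim i)
      have "exp (\<epsilon> i * real (k i)) \<le> exp (L / 2 * real (k i))"
        using elim(1) by (intro iffD2[OF exp_le_cancel_iff] mult_right_mono) auto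
      moreover have "real (N i) \<le> exp (L / 2 * real (k i))"
      proof -
        have "ln (real (N i)) \<le> L / 2 * real (k i)"
          using elim(2) by (simp add: abs_le_iff)
        then have "exp (ln (real (N i))) \<le> exp (L / 2 * real (k i))"
          by simp
        then show ?thesis
          using elim(3) by simp
      qed
      ultimately have num: "exp (\<epsilon> i * real (k i)) + real (N i) \<le> 2 * exp (L / 2 * real (k i))"
        by linarith
      \<comment> \<open>Rounding \<open>k i\<close> down to an even exponent loses at most one
        factor \<open>q\<close>; together with the two summands of the numerator this gives the
        constant \<open>2 * q\<close>.\<close>
      have "real (k i) - 1 \<le> real (2 * (k i div 2))"
        by linarith
      then have "exp (L * (real (k i) - 1)) \<le> exp (L * real (2 * (k i div 2)))"
        using L by simp
      also have "\<dots> = q ^ (2 * (k i div 2))"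
        using exp_of_nat_mult[of "2 * (k i div 2)" L] L by (simp add: mult.commute)
      finally have den: "exp (L * (real (k i) - 1)) \<le> q ^ (2 * (k i div 2))" .
      have "(exp (\<epsilon> i * real (k i)) + real (N i)) / q ^ (2 * (k i div 2))
          \<le> 2 * exp (L / 2 * real (k i)) / exp (L * (real (k i) - 1))"
        using num den by (intro frac_le) auto
      also have "\<dots> = 2 * (exp L * exp (- (L / 2) * real (k i)))"
      proof -
        have "L / 2 * real (k i) - L * (real (k i) - 1) = L + - (L / 2) * real (k i)"
          by (simp add: field_simps)
        then have "exp (L / 2 * real (k i)) / exp (L * (real (k i) - 1)) = exp L * exp (- (L / 2) * real (k i))"
          by (metis exp_add exp_diff)
        then show ?thesis
          by simp
      qed
      finally show ?case
        using L by simp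
    qed
  qed
qed

text \<open>Markov's inequality is applied to the trace plus \<open>n\<close>. The set
  \<open>V\<close> is the event that this variable reaches \<open>q ^ a\<close>: it is measurable
  and contains every outlier, whereas the outlier event itself is not claimed to be
  measurable.\<close>

lemma outlier_probability_le:
  assumes Q: "prob_space Q"
    and A: "bounded_random_mat Q n A" "\<And>w. w \<in> space Q \<Longrightarrow> orth_proj n (A w)"
    and B: "bounded_random_mat Q n B" "\<And>w. w \<in> space Q \<Longrightarrow> orth_proj n (B w)"
    and \<alpha>: "0 < \<alpha>" "\<alpha> < 1" and \<beta>: "0 < \<beta>" "\<beta> < 1" and le1: "\<alpha> + \<beta> \<le> 1"
    and n: "0 < n" and e: "0 < e" and a: "even a"
    and b: "cmod (integral\<^sup>L Q (\<lambda>w. mat_trace (centered_product n \<alpha> \<beta> (A w) (B w) ^\<^sub>m a))) \<le> b"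
  obtains V where "V \<in> sets Q" "measure Q V \<le> (b + real n) / (1 + e / (2 * spread \<alpha> \<beta>)) ^ a"
    "\<And>w. w \<in> space Q \<Longrightarrow> r_plus \<alpha> \<beta> + e \<le> lambda_max (A w * B w * A w) \<Longrightarrow> w \<in> V"
proof -
  interpret prob_space Q by fact
  define T where "T w = mat_trace (centered_product n \<alpha> \<beta> (A w) (B w) ^\<^sub>m a)" for w
  define q where "q = 1 + e / (2 * spread \<alpha> \<beta>)"
  have q: "1 < q"
    using e spread_pos[OF \<alpha> \<beta>] by (simp add: q_def)
  have T_int: "integrable Q T"
    unfolding T_def centered_product_def
    by (intro integrable_mat_trace[OF Q, where n = n] bounded_random_mat_pow bounded_random_mat_mult
        bounded_random_mat_shifted A(1) B(1))
  define V where "V = {w \<in> space Q. q ^ a \<le> Re (T w) + real n}"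
  have u_int: "integrable Q (\<lambda>w. Re (T w) + real n)"
    using T_int by simp
  show ?thesis
  proof (rule that[of V])
    have [measurable]: "(\<lambda>w. Re (T w) + real n) \<in> borel_measurable Q"
      using u_int by simp
    show "V \<in> sets Q"
      unfolding V_def by measurable
    have "measure Q V \<le> (LINT w|Q. Re (T w) + real n) / q ^ a"
      unfolding V_def
    proof (rule integral_Markov_inequality_measure[OF u_int])
      show "AE w in Q. 0 \<le> Re (T w) + real n"
        using Re_trace_centered_product_pow(1)[OF A(2) B(2) \<alpha> \<beta> a]
        by (intro AE_I2) (force simp: T_def)
    qed (use q in auto)
    also have "(LINT w|Q. Re (T w) + real n) = Re (integral\<^sup>L Q T) + real n"
      using T_int by (simp add: prob_space)
    also have "\<dots> / q ^ a \<le> (b + real n) / q ^ a"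
      using b complex_Re_le_cmod[of "integral\<^sup>L Q T"] q
      by (intro divide_right_mono) (auto simp: T_def[abs_def])
    finally show "measure Q V \<le> (b + real n) / (1 + e / (2 * spread \<alpha> \<beta>)) ^ a"
      by (simp add: q_def)
    show "w \<in> V" if "w \<in> space Q" "r_plus \<alpha> \<beta> + e \<le> lambda_max (A w * B w * A w)" for w
      using Re_trace_centered_product_pow(2)[OF A(2) B(2) \<alpha> \<beta> a le1 n e that(2)] that(1)
      by (simp add: V_def T_def q_def)
  qed
qed

lemma lambda_max_conv_in_prob:
  fixes P :: "nat \<Rightarrow> 'w measure" and N k :: "nat \<Rightarrow> nat" and A B :: "nat \<Rightarrow> 'w \<Rightarrow> complex mat"
  assumes prob: "\<And>i. prob_space (P i)"
    and N: "strict_mono N"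
    and A: "\<And>i. bounded_random_mat (P i) (N i) (A i)" "\<And>i w. w \<in> space (P i) \<Longrightarrow> orth_proj (N i) (A i w)"
    and B: "\<And>i. bounded_random_mat (P i) (N i) (B i)" "\<And>i w. w \<in> space (P i) \<Longrightarrow> orth_proj (N i) (B i w)"
    and \<alpha>: "0 < \<alpha>" "\<alpha> < 1" and \<beta>: "0 < \<beta>" "\<beta> < 1"
    and esd: "\<And>f. continuous_on UNIV f \<Longrightarrow> compact_supp f \<Longrightarrow>
       conv_in_prob P (\<lambda>i w. esd_integral (A i w * B i w * A i w) f) (manova_integral \<alpha> \<beta> f)"
    and k: "(\<lambda>i. ln (real (N i))) \<in> o(\<lambda>i. real (k i))"
    and \<epsilon>: "\<epsilon> \<longlonglongrightarrow> 0"
    and moments: "\<And>i a. a \<in> {1..k i} \<Longrightarrow>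
       cmod (integral\<^sup>L (P i) (\<lambda>w. mat_trace (centered_product (N i) \<alpha> \<beta> (A i w) (B i w) ^\<^sub>m a)))
       \<le> exp (\<epsilon> i * real (k i))"
  shows "conv_in_prob P (\<lambda>i w. lambda_max (A i w * B i w * A i w)) (edge \<alpha> \<beta>)"
  unfolding conv_in_prob_def
proof (intro allI impI)
  fix e :: real assume e: "0 < e"
  let ?l = "\<lambda>i w. lambda_max (A i w * B i w * A i w)"
  obtain m c where m: "1 \<le> m" "0 \<le> c"
    and det: "(max 0 (edge \<alpha> \<beta> - e)) ^ m < manova_integral \<alpha> \<beta> (edge_test m c) / 2"
    using edge_detection[OF \<alpha> \<beta> e] by blast
  \<comment> \<open>When the spectral integral drops below half of its limit it deviates from the
    limit by more than this \<open>\<eta>\<close>, so eigenvalues that all lie too low force the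
    event \<open>U i\<close>.\<close>
  define \<eta> where "\<eta> = manova_integral \<alpha> \<beta> (edge_test m c) / 2"
  have \<eta>: "0 < \<eta>"
    using le_less_trans[OF zero_le_power det] by (simp add: \<eta>_def)
  define U where "U i = {w \<in> space (P i).
    dist (esd_integral (A i w * B i w * A i w) (edge_test m c)) (manova_integral \<alpha> \<beta> (edge_test m c)) > \<eta>}" for i
  have U_lim: "(\<lambda>i. measure (P i) (U i)) \<longlonglongrightarrow> 0"
    using esd[OF continuous_edge_test compact_supp_edge_test[OF m(1)], of c] \<eta>
    unfolding conv_in_prob_def U_def by blast
  have U_sets: "U i \<in> sets (P i)" for i
  proof -
    have H: "bounded_random_mat (P i) (N i) (\<lambda>w. A i w * B i w * A i w)"
      using A(1) B(1) by (intro bounded_random_mat_mult)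
    have tr: "(\<lambda>w. mat_trace ((A i w * B i w * A i w) ^\<^sub>m j)) \<in> borel_measurable (P i)" for j
      using integrable_mat_trace[OF prob bounded_random_mat_pow[OF H]] by (rule borel_measurable_integrable)
    have "(\<lambda>w. (Re (mat_trace ((A i w * B i w * A i w) ^\<^sub>m m))
        - c * Re (mat_trace ((A i w * B i w * A i w) ^\<^sub>m Suc m))) / real (N i)) \<in> borel_measurable (P i)"
      using tr[of m] tr[of "Suc m"] by (intro borel_measurable_divide borel_measurable_diff
          borel_measurable_times borel_measurable_const borel_measurable_Re) auto
    then have [measurable]: "(\<lambda>w. esd_integral (A i w * B i w * A i w) (edge_test m c)) \<in> borel_measurable (P i)"
      by (subst measurable_cong[OF esd_integral_edge_test[OF A(2) B(2)]])
    show ?thesis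
      unfolding U_def by measurable
  qed
  have U_low: "w \<in> U i" if w: "w \<in> space (P i)" and n: "0 < N i" and l: "?l i w < edge \<alpha> \<beta> - e" for i w
  proof -
    have "esd_integral (A i w * B i w * A i w) (edge_test m c) \<le> (max 0 (edge \<alpha> \<beta> - e)) ^ m"
      using l by (intro esd_integral_edge_test_le[OF A(2)[OF w] B(2)[OF w] n m(2)]) simp
    then have "esd_integral (A i w * B i w * A i w) (edge_test m c) < manova_integral \<alpha> \<beta> (edge_test m c) / 2"
      using det by linarith
    then have "\<eta> < \<bar>esd_integral (A i w * B i w * A i w) (edge_test m c) - manova_integral \<alpha> \<beta> (edge_test m c)\<bar>"
      unfolding \<eta>_def by linarith
    then show ?thesis
      using w by (simp add: U_def dist_real_def)
  qed
  define q where "q = 1 + e / (2 * spread \<alpha> \<beta>)"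
  have q: "1 < q"
    using e spread_pos[OF \<alpha> \<beta>] by (simp add: q_def)
  note G = growth_bound_tendsto_0[OF N k \<epsilon> q]
  let ?b = "\<lambda>i. (exp (\<epsilon> i * real (k i)) + real (N i)) / q ^ (2 * (k i div 2))"
  \<comment> \<open>The moment bound is invoked at the largest even exponent up to
    \<open>k i\<close>; \<open>2 \<le> k i\<close> keeps that exponent from being 0, which the bound
    does not cover. For \<alpha> + \<beta> > 1 no eigenvalue exceeds the edge and \<open>V\<close>
    is empty.\<close>
  have V_ex: "\<exists>V\<in>sets (P i). measure (P i) V \<le> ?b i \<and> (\<forall>w\<in>space (P i). edge \<alpha> \<beta> + e < ?l i w \<longrightarrow> w \<in> V)"
    if n: "0 < N i" and k2: "2 \<le> k i" for i
  proof (cases "\<alpha> + \<beta> > 1")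
    case True
    have "\<not> edge \<alpha> \<beta> + e < ?l i w" if "w \<in> space (P i)" for w
      using lambda_max_sandwich(4)[OF A(2)[OF that] B(2)[OF that] n] True e by (simp add: edge_def)
    moreover have "0 \<le> ?b i"
      using q by (intro divide_nonneg_pos add_nonneg_nonneg) auto
    ultimately show ?thesis
      by (intro bexI[of _ "{}"]) auto
  next
    case False
    have mem: "2 * (k i div 2) \<in> {1..k i}" and ev: "even (2 * (k i div 2))" and le1: "\<alpha> + \<beta> \<le> 1"
      using k2 False by auto
    obtain V where "V \<in> sets (P i)" "measure (P i) V \<le> ?b i"
      "\<And>w. w \<in> space (P i) \<Longrightarrow> r_plus \<alpha> \<beta> + e \<le> ?l i w \<Longrightarrow> w \<in> V"
      using outlier_probability_le[OF prob[of i] A(1)[of i] A(2)[where i = i] B(1)[of i]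
          B(2)[where i = i] \<alpha> \<beta> le1 n e ev moments[OF mem]]
      unfolding q_def by blast
    then show ?thesis
      using False by (intro bexI[of _ V]) (auto simp: edge_def)
  qed
  show "(\<lambda>i. measure (P i) {w \<in> space (P i). e < dist (?l i w) (edge \<alpha> \<beta>)}) \<longlonglongrightarrow> 0"
  proof (rule tendsto_sandwich[OF _ _ tendsto_const])
    show "(\<lambda>i. measure (P i) (U i) + ?b i) \<longlonglongrightarrow> 0"
      using tendsto_add[OF U_lim G(2)] by simp
    have "eventually (\<lambda>i. 2 \<le> k i) sequentially" "eventually (\<lambda>i. 0 < N i) sequentially"
      using G(1) strict_mono_eventually_pos[OF N] by (auto simp: filterlim_at_top)
    then show "eventually (\<lambda>i. measure (P i) {w \<in> space (P i). e < dist (?l i w) (edge \<alpha> \<beta>)}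
        \<le> measure (P i) (U i) + ?b i) sequentially"
    proof eventually_elim
      case (elim i)
      then obtain V where V: "V \<in> sets (P i)" "measure (P i) V \<le> ?b i"
        "\<And>w. w \<in> space (P i) \<Longrightarrow> edge \<alpha> \<beta> + e < ?l i w \<Longrightarrow> w \<in> V"
        using V_ex by blast
      have "{w \<in> space (P i). e < dist (?l i w) (edge \<alpha> \<beta>)} \<subseteq> U i \<union> V"
      proof safe
        fix w assume w: "w \<in> space (P i)" "e < dist (?l i w) (edge \<alpha> \<beta>)" "w \<notin> V"
        then have "?l i w < edge \<alpha> \<beta> - e"
          using V(3)[OF w(1)] by (auto simp: dist_real_def abs_real_def split: if_splits)
        then show "w \<in> U i"
          using U_low w(1) elim(2) by blast
      qed
      from measure_le_of_subset_Un[OF prob this U_sets V(1)] V(2) show ?case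
        by linarith
    qed
  qed (intro always_eventually allI measure_nonneg)
qed

theorem theorem1p12:
  fixes P :: "nat \<Rightarrow> 'w measure"
    and N :: "nat \<Rightarrow> nat"
    and A B :: "nat \<Rightarrow> 'w \<Rightarrow> complex mat"
    and \<alpha> \<beta> :: real
    and k :: "nat \<Rightarrow> nat"
  assumes prob: "\<And>i. prob_space (P i)"
    and N_incr: "strict_mono N"
    and A_meas: "\<And>i r s. r < N i \<Longrightarrow> s < N i \<Longrightarrow> (\<lambda>w. A i w $$ (r, s)) \<in> borel_measurable (P i)"
    and B_meas: "\<And>i r s. r < N i \<Longrightarrow> s < N i \<Longrightarrow> (\<lambda>w. B i w $$ (r, s)) \<in> borel_measurable (P i)"
    and A_proj: "\<And>i w. w \<in> space (P i) \<Longrightarrow> orth_proj (N i) (A i w)"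
    and B_proj: "\<And>i w. w \<in> space (P i) \<Longrightarrow> orth_proj (N i) (B i w)"
    and \<alpha>_range: "0 < \<alpha>" "\<alpha> < 1"
    and \<beta>_range: "0 < \<beta>" "\<beta> < 1"
    and trA: "conv_in_prob P (\<lambda>i w. mat_trace (A i w) / of_nat (N i)) (complex_of_real \<alpha>)"
    and trB: "conv_in_prob P (\<lambda>i w. mat_trace (B i w) / of_nat (N i)) (complex_of_real \<beta>)"
    and half: "\<alpha> = 1/2 \<or> \<beta> = 1/2"
    and esd: "\<And>f. continuous_on UNIV f \<Longrightarrow> compact_supp f \<Longrightarrow>
       conv_in_prob P (\<lambda>i w. esd_integral (A i w * B i w * A i w) f) (manova_integral \<alpha> \<beta> f)"
    and k_growth: "(\<lambda>i. ln (real (N i))) \<in> o(\<lambda>i. real (k i))"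
    and moments: "\<exists>\<epsilon>::nat \<Rightarrow> real. \<epsilon> \<longlonglongrightarrow> 0 \<and> (\<forall>i. \<forall>a\<in>{1..k i}.
       cmod (integral\<^sup>L (P i) (\<lambda>w. mat_trace ((
          (complex_of_real (1 / sqrt (\<alpha> * (1 - \<alpha>))) \<cdot>\<^sub>m (A i w - complex_of_real \<alpha> \<cdot>\<^sub>m 1\<^sub>m (N i))) *
          (complex_of_real (1 / sqrt (\<beta> * (1 - \<beta>))) \<cdot>\<^sub>m (B i w - complex_of_real \<beta> \<cdot>\<^sub>m 1\<^sub>m (N i))))
          ^\<^sub>m a)))
       \<le> exp (\<epsilon> i * real (k i)))"
  shows "conv_in_prob P (\<lambda>i w. lambda_max (A i w * B i w * A i w)) (edge \<alpha> \<beta>)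
     \<and> conv_in_prob P (\<lambda>i w. (op_norm (A i w * B i w))\<^sup>2) (edge \<alpha> \<beta>)"
proof -
  obtain \<epsilon> where \<epsilon>: "\<epsilon> \<longlonglongrightarrow> 0"
    and bound: "\<And>i a. a \<in> {1..k i} \<Longrightarrow>
      cmod (integral\<^sup>L (P i) (\<lambda>w. mat_trace (centered_product (N i) \<alpha> \<beta> (A i w) (B i w) ^\<^sub>m a)))
      \<le> exp (\<epsilon> i * real (k i))"
    using moments unfolding centered_product_def by blast
  have lambda: "conv_in_prob P (\<lambda>i w. lambda_max (A i w * B i w * A i w)) (edge \<alpha> \<beta>)"
    using prob N_incr bounded_random_orth_proj[OF A_meas A_proj] A_proj
      bounded_random_orth_proj[OF B_meas B_proj] B_proj \<alpha>_range \<beta>_range esd k_growth \<epsilon> bound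
    by (rule lambda_max_conv_in_prob)
  have eq: "(op_norm (A i w * B i w))\<^sup>2 = lambda_max (A i w * B i w * A i w)"
    if "0 < N i" "w \<in> space (P i)" for i w
    using op_norm_proj_product[OF A_proj B_proj] that by blast
  have "conv_in_prob P (\<lambda>i w. (op_norm (A i w * B i w))\<^sup>2) (edge \<alpha> \<beta>)"
    unfolding conv_in_prob_def
  proof (intro allI impI)
    fix e :: real assume "0 < e"
    then have lim: "(\<lambda>i. measure (P i) {w \<in> space (P i).
        e < dist (lambda_max (A i w * B i w * A i w)) (edge \<alpha> \<beta>)}) \<longlonglongrightarrow> 0"
      using lambda unfolding conv_in_prob_def by blast
    \<comment> \<open>The identity between norm and largest eigenvalue needs a nonempty spectrum,
      and dimension 0 can occur only at the first index.\<close>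
    have "eventually (\<lambda>i. 0 < N i) sequentially"
      using N_incr by (rule strict_mono_eventually_pos)
    then have "eventually (\<lambda>i. measure (P i) {w \<in> space (P i).
          e < dist (lambda_max (A i w * B i w * A i w)) (edge \<alpha> \<beta>)} =
        measure (P i) {w \<in> space (P i). e < dist ((op_norm (A i w * B i w))\<^sup>2) (edge \<alpha> \<beta>)}) sequentially"
    proof eventually_elim
      case (elim i)
      have "{w \<in> space (P i). e < dist (lambda_max (A i w * B i w * A i w)) (edge \<alpha> \<beta>)}
          = {w \<in> space (P i). e < dist ((op_norm (A i w * B i w))\<^sup>2) (edge \<alpha> \<beta>)}"
        using eq[OF elim] by auto
      then show ?case
        by simp
    qed
    from Lim_transform_eventually[OF lim this]
    show "(\<lambda>i. measure (P i) {w \<in> space (P i). e < dist ((op_norm (A i w * B i w))\<^sup>2) (edge \<alpha> \<beta>)})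
        \<longlonglongrightarrow> 0" .
  qed
  with lambda show ?thesis
    by blast
qed

end
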